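(* For every operator-valued frame $\{A_j\}_{j\in\mathbb J}$ on $H$ with range in $H_o$, there are a Hilbert space $K$ containing $H$ and $H_o$, a collection of partial isometries $\{V_j\}_{j\in\mathbb J}$ all with the same domain $H_o$ and with mutually orthogonal ranges spanning $K$, and a positive invertible operator $T\in B(H)$ such that $A_j=V_j^*T$ for all $j\in\mathbb J$. In particular, if $\{A_j\}_{j\in\mathbb J}$ is a Parseval frame, then $T$ can be chosen to be the projection on $H$ (i.e., the identity of $H$).
   Context: $H,H_o$ are Hilbert spaces and $\mathbb J$ an index set. A family $\{A_j\}_{j\in\mathbb J}\subset B(H,H_o)$ is an operator-valued frame on $H$ with range in $H_o$ if $S_A:=\sum_jA_j^*A_j$ converges in the strong operator topology (net of finite partial sums) to a bounded positive invertible operator; it is Parseval if $S_A=I$. Containment of $H$ and $H_o$ in $K$ is understood up to isometric identification of $H$ and of $H_o$ with closed subspaces of $K$. The $V_j$ are partial isometries in $B(K)$ with initial space $H_o$, and $V_j^*T$ is viewed as an operator from $H$ to $H_o$. *)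

theory Defs
  imports
    "HOL-Analysis.Analysis"
    "HOL-Library.Function_Algebras"
    "HOL-Library.Nonpos_Ints"
begin

text \<open>
  Complex Hilbert spaces are explicit structures, so that one can quantify existentially over them.
  The underlying set is a linear subspace of an ambient complex vector space, whose addition comes
  from the type and whose scalar multiplication is part of the structure. The inner product is
  linear in its first argument; its values outside the carrier are irrelevant.
\<close>

record 'a hspace =
  hcarrier :: "'a set"
  hscale :: "complex \<Rightarrow> 'a \<Rightarrow> 'a"
  hinner :: "'a \<Rightarrow> 'a \<Rightarrow> complex"

definition hnorm :: "('a, 'm) hspace_scheme \<Rightarrow> 'a \<Rightarrow> real" where
  "hnorm X x = sqrt (Re (hinner X x x))"

locale hilbert_space =
  fixes X :: "('a::ab_group_add, 'm) hspace_scheme" (structure)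
  assumes vector_space: "vector_space (hscale X)"
    and subspace: "module.subspace (hscale X) (hcarrier X)"
    and inner_add: "\<lbrakk>x \<in> hcarrier X; y \<in> hcarrier X; z \<in> hcarrier X\<rbrakk>
      \<Longrightarrow> hinner X (x + y) z = hinner X x z + hinner X y z"
    and inner_scale: "\<lbrakk>x \<in> hcarrier X; y \<in> hcarrier X\<rbrakk>
      \<Longrightarrow> hinner X (hscale X c x) y = c * hinner X x y"
    and inner_commute: "\<lbrakk>x \<in> hcarrier X; y \<in> hcarrier X\<rbrakk>
      \<Longrightarrow> hinner X x y = cnj (hinner X y x)"
    and inner_pos: "\<lbrakk>x \<in> hcarrier X; x \<noteq> 0\<rbrakk> \<Longrightarrow> 0 < Re (hinner X x x)"
    and complete: "\<lbrakk>\<And>n. s n \<in> hcarrier X;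
        \<And>e. 0 < e \<Longrightarrow> \<exists>N. \<forall>m\<ge>N. \<forall>n\<ge>N. hnorm X (s m - s n) < e\<rbrakk>
      \<Longrightarrow> \<exists>l\<in>hcarrier X. (\<lambda>n. hnorm X (s n - l)) \<longlonglongrightarrow> 0"

definition bounded_op ::
  "('a::ab_group_add, 'm) hspace_scheme \<Rightarrow> ('b::ab_group_add, 'n) hspace_scheme \<Rightarrow> ('a \<Rightarrow> 'b) \<Rightarrow> bool" where
  "bounded_op X Y f \<longleftrightarrow>
     (\<forall>x\<in>hcarrier X. f x \<in> hcarrier Y) \<and>
     (\<forall>x\<in>hcarrier X. \<forall>y\<in>hcarrier X. f (x + y) = f x + f y) \<and>
     (\<forall>c. \<forall>x\<in>hcarrier X. f (hscale X c x) = hscale Y c (f x)) \<and>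
     (\<exists>C. \<forall>x\<in>hcarrier X. hnorm Y (f x) \<le> C * hnorm X x)"

definition adj ::
  "('a, 'm) hspace_scheme \<Rightarrow> ('b, 'n) hspace_scheme \<Rightarrow> ('a \<Rightarrow> 'b) \<Rightarrow> 'b \<Rightarrow> 'a" where
  "adj X Y f y = (THE z. z \<in> hcarrier X \<and> (\<forall>x\<in>hcarrier X. hinner Y (f x) y = hinner X x z))"

definition positive_op :: "('a, 'm) hspace_scheme \<Rightarrow> ('a \<Rightarrow> 'a) \<Rightarrow> bool" where
  "positive_op X f \<longleftrightarrow> (\<forall>x\<in>hcarrier X. hinner X (f x) x \<in> \<real>\<^sub>\<ge>\<^sub>0)"

definition invertible_op :: "('a::ab_group_add, 'm) hspace_scheme \<Rightarrow> ('a \<Rightarrow> 'a) \<Rightarrow> bool" where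
  "invertible_op X f \<longleftrightarrow>
     (\<exists>g. bounded_op X X g \<and> (\<forall>x\<in>hcarrier X. g (f x) = x \<and> f (g x) = x))"

definition linear_isometry ::
  "('a::ab_group_add, 'm) hspace_scheme \<Rightarrow> ('b::ab_group_add, 'n) hspace_scheme \<Rightarrow> ('a \<Rightarrow> 'b) \<Rightarrow> bool" where
  "linear_isometry X Y f \<longleftrightarrow>
     bounded_op X Y f \<and> (\<forall>x\<in>hcarrier X. hnorm Y (f x) = hnorm X x)"

text \<open>The initial space of \<open>V\<close> is the orthogonal complement of its kernel.\<close>

definition initial_space :: "('a::zero, 'm) hspace_scheme \<Rightarrow> ('a \<Rightarrow> 'a) \<Rightarrow> 'a set" where
  "initial_space X V =
     {x \<in> hcarrier X. \<forall>y\<in>hcarrier X. V y = 0 \<longrightarrow> hinner X x y = 0}"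

definition partial_isometry :: "('a::ab_group_add, 'm) hspace_scheme \<Rightarrow> ('a \<Rightarrow> 'a) \<Rightarrow> bool" where
  "partial_isometry X V \<longleftrightarrow>
     bounded_op X X V \<and> (\<forall>x\<in>initial_space X V. hnorm X (V x) = hnorm X x)"

definition closed_span :: "('a::ab_group_add, 'm) hspace_scheme \<Rightarrow> 'a set \<Rightarrow> 'a set" where
  "closed_span X S =
     {x \<in> hcarrier X. \<forall>e>0. \<exists>y\<in>module.span (hscale X) S. hnorm X (x - y) < e}"

text \<open>Convergence of \<open>\<Sum>j\<in>J. F j\<close> to \<open>S\<close> in the strong operator topology of \<open>B(X)\<close>.\<close>

definition sot_has_sum ::
  "('a::ab_group_add, 'm) hspace_scheme \<Rightarrow> ('j \<Rightarrow> 'a \<Rightarrow> 'a) \<Rightarrow> 'j set \<Rightarrow> ('a \<Rightarrow> 'a) \<Rightarrow> bool" where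
  "sot_has_sum X F J S \<longleftrightarrow>
     (\<forall>x\<in>hcarrier X. ((\<lambda>I. hnorm X ((\<Sum>j\<in>I. F j x) - S x)) \<longlongrightarrow> 0) (finite_subsets_at_top J))"

definition operator_valued_frame ::
  "('h::ab_group_add, 'm) hspace_scheme \<Rightarrow> ('o::ab_group_add, 'n) hspace_scheme \<Rightarrow>
   'j set \<Rightarrow> ('j \<Rightarrow> 'h \<Rightarrow> 'o) \<Rightarrow> bool" where
  "operator_valued_frame H Ho J A \<longleftrightarrow>
     (\<forall>j\<in>J. bounded_op H Ho (A j)) \<and>
     (\<exists>S. bounded_op H H S \<and> positive_op H S \<and> invertible_op H S \<and>
          sot_has_sum H (\<lambda>j. adj H Ho (A j) \<circ> A j) J S)"

definition parseval_frame ::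
  "('h::ab_group_add, 'm) hspace_scheme \<Rightarrow> ('o::ab_group_add, 'n) hspace_scheme \<Rightarrow>
   'j set \<Rightarrow> ('j \<Rightarrow> 'h \<Rightarrow> 'o) \<Rightarrow> bool" where
  "parseval_frame H Ho J A \<longleftrightarrow>
     operator_valued_frame H Ho J A \<and>
     sot_has_sum H (\<lambda>j. adj H Ho (A j) \<circ> A j) J id"

text \<open>
  \<open>K\<close> contains \<open>H\<close> and \<open>Ho\<close> through the isometries \<open>\<iota>\<close> and \<open>\<kappa>\<close>, whose ranges are automatically
  closed subspaces, and the \<open>V j\<close> are partial isometries with common initial space \<open>\<kappa>(Ho)\<close> and
  with mutually orthogonal ranges spanning \<open>K\<close>.
\<close>

definition dilation_system ::
  "('h::ab_group_add, 'm) hspace_scheme \<Rightarrow> ('o::ab_group_add, 'n) hspace_scheme \<Rightarrow> 'j set \<Rightarrow>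
   ('k::ab_group_add, 'l) hspace_scheme \<Rightarrow> ('h \<Rightarrow> 'k) \<Rightarrow> ('o \<Rightarrow> 'k) \<Rightarrow> ('j \<Rightarrow> 'k \<Rightarrow> 'k) \<Rightarrow> bool" where
  "dilation_system H Ho J K \<iota> \<kappa> V \<longleftrightarrow>
     hilbert_space K \<and> linear_isometry H K \<iota> \<and> linear_isometry Ho K \<kappa> \<and>
     (\<forall>j\<in>J. partial_isometry K (V j) \<and> initial_space K (V j) = \<kappa> ` hcarrier Ho) \<and>
     (\<forall>i\<in>J. \<forall>j\<in>J. i \<noteq> j \<longrightarrow>
        (\<forall>x\<in>hcarrier K. \<forall>y\<in>hcarrier K. hinner K (V i x) (V j y) = 0)) \<and>
     closed_span K (\<Union>j\<in>J. V j ` hcarrier K) = hcarrier K"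

end

theory Submission
  imports Defs
begin

text \<open>
  The dilation space is the Hilbert sum \<open>K = \<ell>\<^sup>2(J, Ho)\<close> of copies of \<open>Ho\<close>, and its \<open>j\<close>-th summand
  is written \<open>e\<^sub>j \<otimes> Ho\<close>. A fixed summand \<open>e\<^sub>0 \<otimes> Ho\<close>, for some index \<open>0\<close> in the nonempty set \<open>J\<close>,
  plays the role of \<open>Ho\<close> inside \<open>K\<close>. The partial isometry \<open>V j\<close> moves this summand onto the
  \<open>j\<close>-th one and kills all others, so its adjoint sends a family \<open>f\<close> to \<open>e\<^sub>0 \<otimes> f j\<close>. The ranges of the
  \<open>V j\<close> are the summands, which are mutually orthogonal and span \<open>K\<close>.

  If \<open>\<Sum>j\<in>J. \<parallel>B j h\<parallel>\<^sup>2 = \<parallel>h\<parallel>\<^sup>2\<close> for all \<open>h\<close>, the analysis operator \<open>h \<mapsto> (B j h)\<^sub>j\<close> embeds \<open>H\<close>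
  isometrically into \<open>K\<close>, and applying the adjoint of \<open>V j\<close> to its values recovers \<open>B j h\<close>
  (\<open>parseval_dilation\<close>). For a Parseval frame this applies to \<open>B = A\<close>. In general,
  \<open>\<Sum>j\<in>J. \<parallel>A j h\<parallel>\<^sup>2 = \<langle>S h, h\<rangle>\<close> for the frame operator \<open>S\<close> (\<open>sot_has_sum_norms\<close>); with \<open>T\<close> the
  positive square root of \<open>S\<close>, the operators \<open>B j = A j \<circ> T\<^sup>-\<^sup>1\<close> satisfy the identity, and
  \<open>A j = B j \<circ> T\<close>.

  The ingredients from Hilbert space theory are the Riesz representation theorem
  (\<open>Riesz_representation\<close>), which provides the adjoints occurring in \<open>S\<close>; the square root of a
  positive invertible operator (\<open>positive_invertible_sqrt\<close>), obtained from a contraction of the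
  operators of norm at most \<open>r < 1\<close>; and the completeness of \<open>\<ell>\<^sup>2(J, Ho)\<close> (\<open>hilbert_space_ell2\<close>).
\<close>

section \<open>Inner product geometry\<close>

context hilbert_space
begin

sublocale V: vector_space "hscale X"
  by (rule vector_space)

abbreviation ip where "ip \<equiv> hinner X"
abbreviation nm where "nm \<equiv> hnorm X"
abbreviation sc where "sc \<equiv> hscale X"
abbreviation C where "C \<equiv> hcarrier X"

lemma zero_in [simp]: "0 \<in> C"
  by (rule V.subspace_0[OF subspace])

lemma add_in [simp]: "x \<in> C \<Longrightarrow> y \<in> C \<Longrightarrow> x + y \<in> C"
  by (rule V.subspace_add[OF subspace])

lemma diff_in [simp]: "x \<in> C \<Longrightarrow> y \<in> C \<Longrightarrow> x - y \<in> C"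
  by (rule V.subspace_diff[OF subspace])

lemma scale_in [simp]: "x \<in> C \<Longrightarrow> sc c x \<in> C"
  by (rule V.subspace_scale[OF subspace])

lemma sum_in: "(\<And>i. i \<in> I \<Longrightarrow> f i \<in> C) \<Longrightarrow> sum f I \<in> C"
  by (rule V.subspace_sum[OF subspace])

lemma inner_zero_left [simp]: "y \<in> C \<Longrightarrow> ip 0 y = 0"
  using inner_add[of 0 0 y] by simp

lemma inner_diff_left:
  assumes "x \<in> C" "y \<in> C" "z \<in> C"
  shows "ip (x - y) z = ip x z - ip y z"
  using inner_add[of "x - y" y z] assms by simp

lemma inner_add_right:
  assumes "x \<in> C" "y \<in> C" "z \<in> C"
  shows "ip x (y + z) = ip x y + ip x z"
  using inner_commute[of x "y + z"] inner_commute[of x y] inner_commute[of x z] assms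
  by (simp add: inner_add)

lemma inner_diff_right:
  assumes "x \<in> C" "y \<in> C" "z \<in> C"
  shows "ip x (y - z) = ip x y - ip x z"
  using inner_add_right[of x "y - z" z] assms by simp

lemma inner_scale_right:
  assumes "x \<in> C" "y \<in> C"
  shows "ip x (sc c y) = cnj c * ip x y"
  using inner_commute[of x "sc c y"] inner_commute[of x y] assms
  by (simp add: inner_scale)

lemma inner_zero_right [simp]: "x \<in> C \<Longrightarrow> ip x 0 = 0"
  using inner_add_right[of x 0 0] by simp

lemma inner_sum_left:
  assumes "\<And>i. i \<in> I \<Longrightarrow> f i \<in> C" "y \<in> C"
  shows "ip (sum f I) y = (\<Sum>i\<in>I. ip (f i) y)"
  using assms(1)
proof (induction I rule: infinite_finite_induct)
  case (insert i I)
  then show ?case using assms(2) by (simp add: inner_add sum_in)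
qed (use assms(2) in auto)

lemmas inner_simps =
  inner_add inner_diff_left inner_add_right inner_diff_right inner_scale inner_scale_right

lemma inner_self_nonneg: "x \<in> C \<Longrightarrow> 0 \<le> Re (ip x x)"
  using inner_pos[of x] by (cases "x = 0") auto

lemma norm_nonneg [simp]: "x \<in> C \<Longrightarrow> 0 \<le> nm x"
  by (simp add: hnorm_def inner_self_nonneg)

lemma norm_sq: "x \<in> C \<Longrightarrow> (nm x)\<^sup>2 = Re (ip x x)"
  by (simp add: hnorm_def inner_self_nonneg)

lemma inner_self: "x \<in> C \<Longrightarrow> ip x x = of_real ((nm x)\<^sup>2)"
  using inner_commute[of x x] by (simp add: norm_sq complex_eq_iff)

lemma norm_zero [simp]: "nm 0 = 0"
  by (simp add: hnorm_def)

lemma norm_eq_0_iff: "x \<in> C \<Longrightarrow> nm x = 0 \<longleftrightarrow> x = 0"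
  using inner_pos[of x] by (cases "x = 0") (auto simp: hnorm_def)

lemma norm_scale:
  assumes "x \<in> C"
  shows "nm (sc c x) = cmod c * nm x"
proof -
  have "(nm (sc c x))\<^sup>2 = Re (cnj c * (c * ip x x))"
    using assms by (simp only: norm_sq scale_in inner_scale inner_scale_right)
  also have "cnj c * (c * ip x x) = of_real ((cmod c * nm x)\<^sup>2)"
    unfolding power_mult_distrib of_real_mult complex_norm_square inner_self[OF assms]
    by (metis mult.assoc mult.commute)
  finally have "(nm (sc c x))\<^sup>2 = (cmod c * nm x)\<^sup>2"
    by (simp only: Re_complex_of_real)
  then show ?thesis using assms by (simp add: power2_eq_imp_eq)
qed

lemma Cauchy_Schwarz:
  assumes x: "x \<in> C" and y: "y \<in> C"
  shows "cmod (ip x y) \<le> nm x * nm y"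
proof (cases "y = 0")
  case False
  define b where "b = (nm y)\<^sup>2"
  have b: "b > 0" using False y norm_eq_0_iff by (simp add: b_def)
  \<comment> \<open>Subtract from \<open>x\<close> its projection onto the line through \<open>y\<close>.\<close>
  define c where "c = ip x y / of_real b"
  have "ip (x - sc c y) (x - sc c y) = ip x x - cnj c * ip x y - c * ip y x + c * cnj c * of_real b"
    using x y by (simp add: inner_simps inner_self[of y] b_def algebra_simps)
  also have "ip y x = cnj (ip x y)" using inner_commute x y by blast
  also have "ip x x - cnj c * ip x y - c * cnj (ip x y) + c * cnj c * of_real b
      = ip x x - of_real ((cmod (ip x y))\<^sup>2 / b)"
  proof -
    have "cnj c * ip x y = of_real ((cmod (ip x y))\<^sup>2 / b)"
      and "c * cnj (ip x y) = of_real ((cmod (ip x y))\<^sup>2 / b)"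
      unfolding of_real_divide complex_norm_square by (simp_all add: c_def)
    moreover have "c * cnj c * of_real b = cnj c * ip x y"
      using b unfolding c_def by simp
    ultimately show ?thesis by (simp only: add_diff_cancel_right' diff_add_cancel)
  qed
  finally have "Re (ip (x - sc c y) (x - sc c y)) = (nm x)\<^sup>2 - (cmod (ip x y))\<^sup>2 / b"
    using x by (simp add: norm_sq del: of_real_divide)
  moreover have "0 \<le> Re (ip (x - sc c y) (x - sc c y))"
    using x y by (simp add: inner_self_nonneg)
  ultimately have "(cmod (ip x y))\<^sup>2 / b \<le> (nm x)\<^sup>2" by linarith
  then have "(cmod (ip x y))\<^sup>2 \<le> (nm x * nm y)\<^sup>2"
    by (simp only: pos_divide_le_eq[OF b] power_mult_distrib flip: b_def)
  then show ?thesis using x y by (meson norm_nonneg mult_nonneg_nonneg power2_le_imp_le)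
qed (use x in simp)

lemma norm_add_sq:
  assumes "x \<in> C" "y \<in> C"
  shows "(nm (x + y))\<^sup>2 = (nm x)\<^sup>2 + 2 * Re (ip x y) + (nm y)\<^sup>2"
  using assms inner_commute[of y x] by (simp add: norm_sq inner_simps)

lemma norm_diff_sq:
  assumes "x \<in> C" "y \<in> C"
  shows "(nm (x - y))\<^sup>2 = (nm x)\<^sup>2 - 2 * Re (ip x y) + (nm y)\<^sup>2"
  using assms inner_commute[of y x] by (simp add: norm_sq inner_simps)

lemma norm_triangle:
  assumes "x \<in> C" "y \<in> C"
  shows "nm (x + y) \<le> nm x + nm y"
proof -
  have "Re (ip x y) \<le> nm x * nm y"
    using Cauchy_Schwarz[OF assms] complex_Re_le_cmod order_trans by blast
  then have "(nm (x + y))\<^sup>2 \<le> (nm x + nm y)\<^sup>2"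
    using assms by (simp add: norm_add_sq power2_sum)
  then show ?thesis using assms by (meson norm_nonneg add_nonneg_nonneg power2_le_imp_le)
qed

lemma norm_minus_commute:
  assumes "x \<in> C" "y \<in> C"
  shows "nm (x - y) = nm (y - x)"
proof -
  have "(nm (x - y))\<^sup>2 = (nm (y - x))\<^sup>2"
    using assms inner_commute[of x y] by (simp add: norm_diff_sq)
  then show ?thesis using assms by (meson norm_nonneg diff_in power2_eq_imp_eq)
qed

lemma norm_triangle_diff:
  assumes "x \<in> C" "y \<in> C" "z \<in> C"
  shows "nm (x - z) \<le> nm (x - y) + nm (y - z)"
  using norm_triangle[of "x - y" "y - z"] assms by simp

lemma tendsto_inner_left:
  assumes s: "\<And>n. s n \<in> C" and "l \<in> C" "x \<in> C"
    and lim: "((\<lambda>n. nm (s n - l)) \<longlongrightarrow> 0) F"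
  shows "((\<lambda>n. ip (s n) x) \<longlongrightarrow> ip l x) F"
proof -
  have "((\<lambda>n. ip (s n) x - ip l x) \<longlongrightarrow> 0) F"
  proof (rule Lim_null_comparison)
    show "\<forall>\<^sub>F n in F. norm (ip (s n) x - ip l x) \<le> nm (s n - l) * nm x"
      using Cauchy_Schwarz[of "s _ - l" x] assms by (simp add: inner_diff_left)
    show "((\<lambda>n. nm (s n - l) * nm x) \<longlongrightarrow> 0) F"
      using tendsto_mult_right[OF lim, of "nm x"] by simp
  qed
  then show ?thesis by (simp add: LIM_zero_iff)
qed

lemma tendsto_inner_right:
  assumes s: "\<And>n. s n \<in> C" and "l \<in> C" "x \<in> C"
    and "((\<lambda>n. nm (s n - l)) \<longlongrightarrow> 0) F"
  shows "((\<lambda>n. ip x (s n)) \<longlongrightarrow> ip x l) F"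
  using tendsto_cnj[OF tendsto_inner_left[OF assms]] inner_commute[of x] assms by simp

lemma tendsto_norm:
  assumes s: "\<And>n. s n \<in> C" and "l \<in> C"
    and lim: "((\<lambda>n. nm (s n - l)) \<longlongrightarrow> 0) F"
  shows "((\<lambda>n. nm (s n)) \<longlongrightarrow> nm l) F"
proof -
  have "((\<lambda>n. nm (s n) - nm l) \<longlongrightarrow> 0) F"
  proof (rule Lim_null_comparison[OF _ lim], rule always_eventually, rule allI)
    fix n
    show "norm (nm (s n) - nm l) \<le> nm (s n - l)"
      using norm_triangle[of "s n - l" l] norm_triangle[of "l - s n" "s n"]
        norm_minus_commute[of l "s n"] assms by auto
  qed
  then show ?thesis by (simp add: LIM_zero_iff)
qed

lemma limit_unique:
  assumes "\<And>n. s n \<in> C" "l \<in> C" "l' \<in> C"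
    and "(\<lambda>n. nm (s n - l)) \<longlonglongrightarrow> 0" "(\<lambda>n. nm (s n - l')) \<longlonglongrightarrow> 0"
  shows "l = l'"
proof -
  have "(\<lambda>n. nm (s n - l) + nm (s n - l')) \<longlonglongrightarrow> 0"
    using tendsto_add[OF assms(4,5)] by simp
  moreover have "nm (l - l') \<le> nm (s n - l) + nm (s n - l')" for n
    using norm_triangle_diff[of l "s n" l'] norm_minus_commute[of l "s n"] assms by simp
  ultimately have "nm (l - l') \<le> 0"
    by (intro LIMSEQ_le_const) auto
  then have "nm (l - l') = 0" using assms(2,3) by (intro antisym) auto
  then show ?thesis using norm_eq_0_iff[of "l - l'"] assms by simp
qed

lemma inner_right_unique:
  assumes "z \<in> C" "w \<in> C" "\<And>x. x \<in> C \<Longrightarrow> ip x z = ip x w"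
  shows "z = w"
proof -
  have "ip (z - w) (z - w) = 0"
    using assms by (simp add: inner_diff_right)
  then show ?thesis using assms norm_eq_0_iff[of "z - w"] by (simp add: hnorm_def)
qed

end

section \<open>Riesz representation and adjoints\<close>

lemma (in hilbert_space) norm_parallelogram:
  assumes "x \<in> C" "y \<in> C"
  shows "(nm (x + y))\<^sup>2 + (nm (x - y))\<^sup>2 = 2 * (nm x)\<^sup>2 + 2 * (nm y)\<^sup>2"
  using assms by (simp add: norm_add_sq norm_diff_sq)

text \<open>
  The Riesz vector of \<open>\<phi>\<close> minimises the functional \<open>z \<mapsto> \<parallel>z\<parallel>\<^sup>2 - 2 Re \<phi>(z)\<close>: this functional is
  bounded below, the parallelogram law makes minimising sequences Cauchy, and its first variation
  at the limit vanishes.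
\<close>

lemma (in hilbert_space) Riesz_representation:
  fixes \<phi> :: "'a \<Rightarrow> complex"
  assumes add: "\<And>x y. x \<in> C \<Longrightarrow> y \<in> C \<Longrightarrow> \<phi> (x + y) = \<phi> x + \<phi> y"
    and scale: "\<And>c x. x \<in> C \<Longrightarrow> \<phi> (sc c x) = c * \<phi> x"
    and bound: "\<And>x. x \<in> C \<Longrightarrow> cmod (\<phi> x) \<le> B * nm x"
  obtains z where "z \<in> C" "\<And>x. x \<in> C \<Longrightarrow> \<phi> x = ip x z"
proof -
  define q where "q z = (nm z)\<^sup>2 - 2 * Re (\<phi> z)" for z
  define m where "m = Inf (q ` C)"
  have q_ge: "- (B\<^sup>2) \<le> q z" if "z \<in> C" for z
  proof -
    have "Re (\<phi> z) \<le> B * nm z"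
      using bound[OF that] complex_Re_le_cmod order_trans by blast
    moreover have "0 \<le> (nm z - B)\<^sup>2" by simp
    ultimately show ?thesis by (simp add: q_def power2_eq_square algebra_simps)
  qed
  have bdd: "bdd_below (q ` C)" using q_ge by (meson bdd_belowI2)
  have m_le: "m \<le> q z" if "z \<in> C" for z
    unfolding m_def using bdd that by (intro cInf_lower) auto
  have "\<exists>z\<in>C. q z < m + 1 / real (Suc n)" for n
  proof -
    have "q ` C \<noteq> {}" using zero_in by blast
    moreover have "Inf (q ` C) < m + 1 / real (Suc n)" by (simp add: m_def)
    ultimately show ?thesis using cInf_less_iff[OF _ bdd] by auto
  qed
  then obtain s where s: "\<And>n. s n \<in> C" and qs: "\<And>n. q (s n) < m + 1 / real (Suc n)"
    by metis
  have close: "(nm (x - y))\<^sup>2 \<le> 2 * (q x - m) + 2 * (q y - m)" if "x \<in> C" "y \<in> C" for x y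
  proof -
    let ?h = "sc (1/2) (x + y)"
    have "4 * (nm ?h)\<^sup>2 = (nm (x + y))\<^sup>2"
      using that by (simp add: norm_scale power2_eq_square)
    moreover have "2 * Re (\<phi> ?h) = Re (\<phi> x) + Re (\<phi> y)" using that by (simp add: scale add)
    moreover have "m \<le> q ?h" using that by (intro m_le) simp
    ultimately show ?thesis
      using norm_parallelogram[OF that] by (simp add: q_def)
  qed
  have "\<exists>l\<in>C. (\<lambda>n. nm (s n - l)) \<longlonglongrightarrow> 0"
  proof (rule complete[OF s])
    fix e :: real assume "0 < e"
    then obtain N where N: "1 / real (Suc N) < e\<^sup>2 / 4"
      by (metis divide_pos_pos nat_approx_posE zero_less_numeral zero_less_power)
    show "\<exists>N. \<forall>m\<ge>N. \<forall>n\<ge>N. nm (s m - s n) < e"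
    proof (intro exI allI impI)
      fix i k assume ik: "N \<le> i" "N \<le> k"
      have "1 / real (Suc i) \<le> 1 / real (Suc N)" "1 / real (Suc k) \<le> 1 / real (Suc N)"
        using ik by (auto intro!: divide_left_mono)
      then have "q (s i) < m + e\<^sup>2 / 4" "q (s k) < m + e\<^sup>2 / 4"
        using qs[of i] qs[of k] N by (auto intro: less_trans order.strict_trans2)
      then have "(nm (s i - s k))\<^sup>2 < e\<^sup>2"
        using close[OF s s, of i k] by argo
      then show "nm (s i - s k) < e" using \<open>0 < e\<close> by (simp add: power2_less_imp_less)
    qed
  qed
  then obtain l where l: "l \<in> C" and lim: "(\<lambda>n. nm (s n - l)) \<longlonglongrightarrow> 0" by blast
  have Re_eq: "Re (\<phi> x) = Re (ip x l)" if x: "x \<in> C" for x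
  proof -
    define D where "D = Re (ip x l) - Re (\<phi> x)"
    have nonneg: "0 \<le> t\<^sup>2 * (nm x)\<^sup>2 + 2 * t * D" for t
    proof -
      let ?D = "\<lambda>n. Re (ip x (s n)) - Re (\<phi> x)"
      have "0 \<le> 1 / real (Suc n) + t\<^sup>2 * (nm x)\<^sup>2 + 2 * t * ?D n" for n
      proof -
        have "m \<le> q (s n + sc (of_real t) x)" using s x by (intro m_le) simp
        also have "\<dots> = q (s n) + t\<^sup>2 * (nm x)\<^sup>2 + 2 * t * ?D n"
          using s x inner_commute[of "s n" x]
          by (simp add: q_def norm_add_sq norm_scale inner_scale_right add scale
              power_mult_distrib algebra_simps)
        finally show ?thesis using qs[of n] by linarith
      qed
      moreover have "(\<lambda>n. 1 / real (Suc n) + t\<^sup>2 * (nm x)\<^sup>2 + 2 * t * ?D n)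
          \<longlonglongrightarrow> 0 + t\<^sup>2 * (nm x)\<^sup>2 + 2 * t * D"
        unfolding D_def
        using LIMSEQ_Suc[OF lim_1_over_n] tendsto_inner_right[OF s l x lim]
        by (intro tendsto_intros) auto
      ultimately show ?thesis by (intro LIMSEQ_le_const) auto
    qed
    define a where "a = (nm x)\<^sup>2 + 1"
    have a: "a > 0" by (simp add: a_def add_nonneg_pos)
    have "0 \<le> (D / a)\<^sup>2 * (nm x)\<^sup>2 - 2 * (D / a) * D"
      using nonneg[of "- (D / a)"] by simp
    also have "\<dots> \<le> (D / a)\<^sup>2 * a - 2 * (D / a) * D"
      by (simp add: a_def mult_left_mono)
    also have "\<dots> = - (D\<^sup>2 / a)" using a by (simp add: field_simps power2_eq_square)
    finally have "D = 0" using a by (simp add: divide_le_0_iff)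
    then show ?thesis by (simp add: D_def)
  qed
  have "\<phi> x = ip x l" if x: "x \<in> C" for x
  proof (rule complex_eqI)
    show "Im (\<phi> x) = Im (ip x l)"
      using Re_eq[of "sc \<i> x"] x l by (simp add: scale inner_scale)
  qed (rule Re_eq[OF x])
  with l show ?thesis using that by blast
qed

lemma bounded_opD:
  assumes "bounded_op X Y f"
  shows "x \<in> hcarrier X \<Longrightarrow> f x \<in> hcarrier Y"
    and "x \<in> hcarrier X \<Longrightarrow> y \<in> hcarrier X \<Longrightarrow> f (x + y) = f x + f y"
    and "x \<in> hcarrier X \<Longrightarrow> f (hscale X c x) = hscale Y c (f x)"
  using assms by (auto simp: bounded_op_def)

text \<open>The bound is taken at least \<open>1\<close> so that it can be divided by.\<close>

lemma bounded_op_bound: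
  assumes "bounded_op X Y f" "hilbert_space X"
  obtains B where "B \<ge> 1" "\<And>x. x \<in> hcarrier X \<Longrightarrow> hnorm Y (f x) \<le> B * hnorm X x"
proof -
  obtain B where B: "\<And>x. x \<in> hcarrier X \<Longrightarrow> hnorm Y (f x) \<le> B * hnorm X x"
    using assms(1) unfolding bounded_op_def by blast
  show ?thesis
  proof
    fix x assume x: "x \<in> hcarrier X"
    then show "hnorm Y (f x) \<le> max 1 B * hnorm X x"
      using B[OF x] mult_right_mono[of B "max 1 B" "hnorm X x"]
        hilbert_space.norm_nonneg[OF assms(2) x] by linarith
  qed simp
qed

lemma bounded_op_diff:
  assumes "hilbert_space X" "bounded_op X Y f" "x \<in> hcarrier X" "y \<in> hcarrier X"
  shows "f (x - y) = f x - f y"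
  using bounded_opD(2)[OF assms(2), of "x - y" y] assms(3,4) hilbert_space.diff_in[OF assms(1)]
  by simp

lemma bounded_op_comp:
  assumes "hilbert_space X" "hilbert_space Y" "bounded_op X Y f" "bounded_op Y Z g"
  shows "bounded_op X Z (g \<circ> f)"
proof -
  obtain B where B: "B \<ge> 1" "\<And>x. x \<in> hcarrier X \<Longrightarrow> hnorm Y (f x) \<le> B * hnorm X x"
    using bounded_op_bound[OF assms(3,1)] by blast
  obtain D where D: "D \<ge> 1" "\<And>y. y \<in> hcarrier Y \<Longrightarrow> hnorm Z (g y) \<le> D * hnorm Y y"
    using bounded_op_bound[OF assms(4,2)] by blast
  have "hnorm Z (g (f x)) \<le> (D * B) * hnorm X x" if "x \<in> hcarrier X" for x
  proof -
    have "hnorm Z (g (f x)) \<le> D * hnorm Y (f x)"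
      using D(2) bounded_opD(1)[OF assms(3) that] by blast
    also have "\<dots> \<le> D * (B * hnorm X x)"
      using B(2)[OF that] D(1) by (intro mult_left_mono) auto
    finally show ?thesis by (simp add: mult.assoc)
  qed
  then have "\<exists>B. \<forall>x\<in>hcarrier X. hnorm Z (g (f x)) \<le> B * hnorm X x" by blast
  then show ?thesis
    using bounded_opD[OF assms(3)] bounded_opD[OF assms(4)] by (simp add: bounded_op_def)
qed

lemma adj_eqI:
  assumes "hilbert_space X" "z \<in> hcarrier X"
    and "\<And>x. x \<in> hcarrier X \<Longrightarrow> hinner Y (f x) y = hinner X x z"
  shows "adj X Y f y = z"
  unfolding adj_def
proof (rule the_equality)
  fix w assume w: "w \<in> hcarrier X \<and> (\<forall>x\<in>hcarrier X. hinner Y (f x) y = hinner X x w)"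
  show "w = z"
    by (rule hilbert_space.inner_right_unique[OF assms(1)]) (use w assms in auto)
qed (use assms in auto)

text \<open>
  The Riesz vector of \<open>x \<mapsto> \<langle>f x, y\<rangle>\<close> witnesses the definite description in the definition of the
  adjoint.
\<close>

lemma adj_props:
  assumes X: "hilbert_space X" and Y: "hilbert_space Y" and f: "bounded_op X Y f"
    and y: "y \<in> hcarrier Y"
  shows adj_in: "adj X Y f y \<in> hcarrier X"
    and adj_inner: "x \<in> hcarrier X \<Longrightarrow> hinner X x (adj X Y f y) = hinner Y (f x) y"
proof -
  interpret X: hilbert_space X by (rule X)
  interpret Y: hilbert_space Y by (rule Y)
  obtain B where B: "\<And>x. x \<in> hcarrier X \<Longrightarrow> hnorm Y (f x) \<le> B * hnorm X x"
    using bounded_op_bound[OF f X] by blast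
  obtain z where z: "z \<in> hcarrier X" "\<And>x. x \<in> hcarrier X \<Longrightarrow> hinner Y (f x) y = hinner X x z"
  proof (rule X.Riesz_representation[of "\<lambda>x. hinner Y (f x) y" "B * hnorm Y y"])
    fix x assume x: "x \<in> hcarrier X"
    have "cmod (hinner Y (f x) y) \<le> hnorm Y (f x) * hnorm Y y"
      using Y.Cauchy_Schwarz[OF bounded_opD(1)[OF f x] y] .
    also have "\<dots> \<le> B * hnorm X x * hnorm Y y"
      using B[OF x] y by (intro mult_right_mono) auto
    finally show "cmod (hinner Y (f x) y) \<le> B * hnorm Y y * hnorm X x"
      by (simp add: mult_ac)
  qed (use bounded_opD[OF f] y in \<open>auto simp: Y.inner_add Y.inner_scale\<close>)
  have "adj X Y f y = z" by (rule adj_eqI[OF X z])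
  then show "adj X Y f y \<in> hcarrier X"
    and "x \<in> hcarrier X \<Longrightarrow> hinner X x (adj X Y f y) = hinner Y (f x) y"
    using z by auto
qed

section \<open>Square roots of positive invertible operators\<close>

context hilbert_space
begin

lemma conv_add:
  assumes "\<And>n. s n \<in> C" "\<And>n. t n \<in> C" "l \<in> C" "k \<in> C"
    and "((\<lambda>n. nm (s n - l)) \<longlongrightarrow> 0) F" "((\<lambda>n. nm (t n - k)) \<longlongrightarrow> 0) F"
  shows "((\<lambda>n. nm ((s n + t n) - (l + k))) \<longlongrightarrow> 0) F"
proof (rule Lim_null_comparison)
  show "\<forall>\<^sub>F n in F. norm (nm (s n + t n - (l + k))) \<le> nm (s n - l) + nm (t n - k)"
    using norm_triangle[of "s _ - l" "t _ - k"] assms by (simp add: algebra_simps)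
  show "((\<lambda>n. nm (s n - l) + nm (t n - k)) \<longlongrightarrow> 0) F"
    using tendsto_add[OF assms(5,6)] by simp
qed

lemma conv_scale:
  assumes "\<And>n. s n \<in> C" "l \<in> C" and "((\<lambda>n. nm (s n - l)) \<longlongrightarrow> 0) F"
  shows "((\<lambda>n. nm (sc c (s n) - sc c l)) \<longlongrightarrow> 0) F"
  using tendsto_mult_left[OF assms(3), of "cmod c"] assms(1,2)
  by (simp add: norm_scale flip: V.scale_right_diff_distrib)

lemma geometric_convergent:
  assumes s: "\<And>n. s n \<in> C" and step: "\<And>n. nm (s (Suc n) - s n) \<le> r ^ n * B"
    and r: "0 \<le> r" "r < 1" and B: "0 \<le> B"
  shows "\<exists>l\<in>C. (\<lambda>n. nm (s n - l)) \<longlonglongrightarrow> 0"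
proof (rule complete[OF s])
  fix e :: real assume e: "0 < e"
  \<comment> \<open>The right-hand side is \<open>B\<close> times the sum of \<open>r ^ i\<close> over \<open>n \<le> i < n + k\<close>.\<close>
  have tail: "nm (s (n + k) - s n) \<le> B * (r ^ n - r ^ (n + k)) / (1 - r)" for n k
  proof (induction k)
    case (Suc k)
    have "nm (s (n + Suc k) - s n) \<le> nm (s (Suc (n + k)) - s (n + k)) + nm (s (n + k) - s n)"
      using norm_triangle_diff[OF s s s] by simp
    also have "\<dots> \<le> r ^ (n + k) * B + B * (r ^ n - r ^ (n + k)) / (1 - r)"
      using step Suc by (intro add_mono)
    also have "\<dots> = B * (r ^ n - r ^ (n + Suc k)) / (1 - r)"
      using r by (simp add: field_simps)
    finally show ?case .
  qed simp
  have tail': "nm (s m - s n) \<le> B / (1 - r) * r ^ n" if "n \<le> m" for m n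
  proof -
    have "nm (s m - s n) \<le> B * (r ^ n - r ^ m) / (1 - r)"
      using tail[of n "m - n"] that by simp
    also have "\<dots> \<le> B * r ^ n / (1 - r)"
      using r B by (intro divide_right_mono mult_left_mono) auto
    finally show ?thesis by simp
  qed
  have "(\<lambda>n. B / (1 - r) * r ^ n) \<longlonglongrightarrow> B / (1 - r) * 0"
    using r by (intro tendsto_mult_left LIMSEQ_realpow_zero)
  then have "\<forall>\<^sub>F n in sequentially. B / (1 - r) * r ^ n < e / 2"
    using e by (intro order_tendstoD(2)) auto
  then obtain N where N: "B / (1 - r) * r ^ N < e / 2"
    by (auto simp: eventually_sequentially)
  show "\<exists>N. \<forall>m\<ge>N. \<forall>n\<ge>N. nm (s m - s n) < e"
  proof (intro exI allI impI)
    fix m n assume "N \<le> m" "N \<le> n"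
    then have "nm (s m - s N) + nm (s N - s n) < e"
      using tail'[of N m] tail'[of N n] norm_minus_commute[OF s s, of N n] N by linarith
    then show "nm (s m - s n) < e"
      using norm_triangle_diff[OF s s s, of m n N] by linarith
  qed
qed

text \<open>
  Polarisation: the quadratic form of \<open>S\<close> is real at \<open>x\<close>, \<open>y\<close>, \<open>x + y\<close> and \<open>x + \<i>y\<close>.
\<close>

lemma positive_op_symmetric:
  assumes S: "bounded_op X X S" and pos: "positive_op X S" and x: "x \<in> C" and y: "y \<in> C"
  shows "ip (S x) y = ip x (S y)"
proof -
  have Im0: "Im (ip (S z) z) = 0" if "z \<in> C" for z
    using pos that by (auto simp: positive_op_def complex_nonneg_Reals_iff)
  have "Im (ip (S x) y) + Im (ip (S y) x) = 0"
    using Im0[of "x + y"] Im0[OF x] Im0[OF y] x y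
    by (simp add: bounded_opD[OF S] inner_add inner_add_right)
  moreover have "Re (ip (S y) x) - Re (ip (S x) y) = 0"
    using Im0[of "x + sc \<i> y"] Im0[OF x] Im0[OF y] x y
    by (simp add: bounded_opD[OF S] inner_simps)
  ultimately have "ip (S x) y = cnj (ip (S y) x)"
    by (intro complex_eqI) auto
  then show ?thesis using inner_commute[of x "S y"] bounded_opD(1)[OF S] x y by simp
qed

lemma bounded_opI:
  assumes "\<And>x. x \<in> C \<Longrightarrow> f x \<in> C"
    and "\<And>x y. x \<in> C \<Longrightarrow> y \<in> C \<Longrightarrow> f (x + y) = f x + f y"
    and "\<And>c x. x \<in> C \<Longrightarrow> f (sc c x) = sc c (f x)"
    and "\<And>x. x \<in> C \<Longrightarrow> nm (f x) \<le> B * nm x"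
  shows "bounded_op X X f"
  unfolding bounded_op_def using assms by blast

text \<open>
  If \<open>R\<close> is symmetric of norm at most \<open>r < 1\<close>, the map \<open>Y \<mapsto> (R + Y\<^sup>2) / 2\<close> is a contraction of
  the set of operators of norm at most \<open>r\<close>. Its fixed point satisfies \<open>(1 - Y)\<^sup>2 = 1 - R\<close>, and it is
  symmetric because all the iterates starting at \<open>0\<close> are.
\<close>

lemma sqrt_iteration:
  assumes R: "bounded_op X X R" and R_sym: "\<And>x y. x \<in> C \<Longrightarrow> y \<in> C \<Longrightarrow> ip (R x) y = ip x (R y)"
    and R_bound: "\<And>x. x \<in> C \<Longrightarrow> nm (R x) \<le> r * nm x" and r: "0 \<le> r" "r < 1"
  obtains Y where "bounded_op X X Y"
    and "\<And>x y. x \<in> C \<Longrightarrow> y \<in> C \<Longrightarrow> ip (Y x) y = ip x (Y y)"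
    and "\<And>x. x \<in> C \<Longrightarrow> nm (Y x) \<le> r * nm x"
    and "\<And>x. x \<in> C \<Longrightarrow> Y x + Y x = R x + Y (Y x)"
proof -
  define good where "good Y \<longleftrightarrow> bounded_op X X Y \<and> (\<forall>x\<in>C. \<forall>y\<in>C. ip (Y x) y = ip x (Y y))
    \<and> (\<forall>x\<in>C. nm (Y x) \<le> r * nm x)" for Y
  define \<Phi> where "\<Phi> Y x = sc (1/2) (R x + Y (Y x))" for Y x
  define Z where "Z n = (\<Phi> ^^ n) (\<lambda>_. 0)" for n
  have Z0: "Z 0 x = 0" and Z_Suc: "Z (Suc n) x = sc (1/2) (R x + Z n (Z n x))" for n x
    by (simp_all add: Z_def \<Phi>_def)
  have good_\<Phi>: "good (\<Phi> Y)" if "good Y" for Y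
  proof -
    have Y: "bounded_op X X Y" and Ysym: "\<And>x y. x \<in> C \<Longrightarrow> y \<in> C \<Longrightarrow> ip (Y x) y = ip x (Y y)"
      and Yb: "\<And>x. x \<in> C \<Longrightarrow> nm (Y x) \<le> r * nm x"
      using that by (auto simp: good_def)
    note D = bounded_opD[OF Y] bounded_opD[OF R]
    have b: "nm (\<Phi> Y x) \<le> r * nm x" if x: "x \<in> C" for x
    proof -
      have "nm (Y (Y x)) \<le> r * (r * nm x)"
        using Yb[of "Y x"] Yb[OF x] mult_left_mono[OF Yb[OF x] r(1)] D x by fastforce
      also have "\<dots> \<le> 1 * (r * nm x)"
        using r x by (intro mult_right_mono) auto
      finally have "nm (R x + Y (Y x)) \<le> r * nm x + r * nm x"
        using norm_triangle[of "R x" "Y (Y x)"] R_bound[OF x] D x by fastforce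
      then show ?thesis using x D by (simp add: \<Phi>_def norm_scale)
    qed
    have "bounded_op X X (\<Phi> Y)"
      by (rule bounded_opI[OF _ _ _ b])
        (use D in \<open>auto simp: \<Phi>_def V.scale_right_distrib V.scale_left_commute algebra_simps\<close>)
    moreover have "ip (\<Phi> Y x) y = ip x (\<Phi> Y y)" if "x \<in> C" "y \<in> C" for x y
      using that D Ysym R_sym by (simp add: \<Phi>_def inner_simps)
    ultimately show ?thesis using b by (simp add: good_def)
  qed
  have good_Z: "good (Z n)" for n
  proof (induction n)
    case 0
    have "bounded_op X X (\<lambda>_. 0)" by (rule bounded_opI[of _ 0]) auto
    then show ?case using r by (simp add: good_def Z_def)
  next
    case (Suc n)
    then show ?case using good_\<Phi> by (simp add: Z_def)
  qed
  then have Z: "\<And>n. bounded_op X X (Z n)"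
    and Z_sym: "\<And>n x y. x \<in> C \<Longrightarrow> y \<in> C \<Longrightarrow> ip (Z n x) y = ip x (Z n y)"
    and Z_bound: "\<And>n x. x \<in> C \<Longrightarrow> nm (Z n x) \<le> r * nm x"
    by (auto simp: good_def)
  note Z_in = bounded_opD(1)[OF Z] and R_in = bounded_opD(1)[OF R]
  \<comment> \<open>\<open>U\<^sup>2 - W\<^sup>2 = (U - W) U + W (U - W)\<close>, and both \<open>U\<close> and \<open>W\<close> have norm at most \<open>r\<close>.\<close>
  have step: "nm (Z (Suc n) x - Z n x) \<le> r ^ n * nm x" if "x \<in> C" for n x
    using that
  proof (induction n arbitrary: x)
    case 0
    have "nm (R x) \<le> r * nm x" by (rule R_bound[OF 0])
    also have "\<dots> \<le> 1 * nm x" using r 0 by (intro mult_right_mono) auto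
    finally have "nm (R x) \<le> 2 * nm x" using norm_nonneg[OF 0] by linarith
    then show ?case using 0 R_in by (simp add: Z_Suc Z0 norm_scale)
  next
    case (Suc n)
    let ?u = "Z (Suc n) x" and ?v = "Z n x"
    have uv: "?u \<in> C" "?v \<in> C" using Z_in Suc.prems by auto
    have "Z (Suc (Suc n)) x - Z (Suc n) x
        = sc (1/2) (R x + Z (Suc n) ?u) - sc (1/2) (R x + Z n ?v)"
      by (simp only: Z_Suc)
    also have "\<dots> = sc (1/2) ((Z (Suc n) ?u - Z n ?u) + Z n (?u - ?v))"
      using bounded_op_diff[OF hilbert_space_axioms Z uv, of n]
      by (simp flip: V.scale_right_diff_distrib)
    finally have "2 * nm (Z (Suc (Suc n)) x - Z (Suc n) x)
        = nm ((Z (Suc n) ?u - Z n ?u) + Z n (?u - ?v))"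
      using uv Z_in by (simp add: norm_scale)
    also have "\<dots> \<le> nm (Z (Suc n) ?u - Z n ?u) + nm (Z n (?u - ?v))"
      using uv Z_in by (intro norm_triangle) auto
    also have "\<dots> \<le> r ^ n * nm ?u + r * nm (?u - ?v)"
      using uv Suc.IH[of ?u] Z_bound[of "?u - ?v"] by (intro add_mono) auto
    also have "\<dots> \<le> r ^ n * (r * nm x) + r * (r ^ n * nm x)"
      using Suc Z_bound r by (intro add_mono mult_left_mono) auto
    finally show ?case by (simp add: mult_ac)
  qed
  have "\<exists>l\<in>C. (\<lambda>n. nm (Z n x - l)) \<longlonglongrightarrow> 0" if x: "x \<in> C" for x
    using Z_in[OF x] step[OF x] r norm_nonneg[OF x] by (rule geometric_convergent)
  then obtain Y where Y_in: "\<And>x. x \<in> C \<Longrightarrow> Y x \<in> C"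
    and lim: "\<And>x. x \<in> C \<Longrightarrow> (\<lambda>n. nm (Z n x - Y x)) \<longlonglongrightarrow> 0"
    by metis
  have Y_bound: "nm (Y x) \<le> r * nm x" if x: "x \<in> C" for x
    using tendsto_norm[OF Z_in[OF x] Y_in[OF x] lim[OF x]] Z_bound[OF x]
    by (intro LIMSEQ_le_const2) auto
  have "bounded_op X X Y"
  proof (rule bounded_opI[OF Y_in _ _ Y_bound])
    show "Y (x + y) = Y x + Y y" if x: "x \<in> C" and y: "y \<in> C" for x y
      using x y lim[of "x + y"] conv_add[OF Z_in[OF x] Z_in[OF y] Y_in[OF x] Y_in[OF y] lim[OF x] lim[OF y]]
        bounded_opD(2)[OF Z x y] Z_in Y_in
      by (intro limit_unique[of "\<lambda>n. Z n (x + y)"]) auto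
    show "Y (sc c x) = sc c (Y x)" if x: "x \<in> C" for c x
      using x lim[of "sc c x"] conv_scale[OF Z_in[OF x] Y_in[OF x] lim[OF x]]
        bounded_opD(3)[OF Z x] Z_in Y_in
      by (intro limit_unique[of "\<lambda>n. Z n (sc c x)"]) auto
  qed
  moreover have "ip (Y x) y = ip x (Y y)" if x: "x \<in> C" and y: "y \<in> C" for x y
    using tendsto_inner_left[OF Z_in[OF x] Y_in[OF x] y lim[OF x]]
      tendsto_inner_right[OF Z_in[OF y] Y_in[OF y] x lim[OF y]] Z_sym[OF x y]
    by (simp add: LIMSEQ_unique)
  moreover have "Y x + Y x = R x + Y (Y x)" if x: "x \<in> C" for x
  proof -
    have "(\<lambda>n. nm (Z n (Z n x) - Y (Y x))) \<longlonglongrightarrow> 0"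
    proof (rule Lim_null_comparison, rule always_eventually, rule allI)
      fix n
      have "Z n (Z n x) - Y (Y x) = Z n (Z n x - Y x) + (Z n (Y x) - Y (Y x))"
        using bounded_op_diff[OF hilbert_space_axioms Z Z_in[OF x] Y_in[OF x], of n n] by simp
      then have "nm (Z n (Z n x) - Y (Y x)) \<le> nm (Z n (Z n x - Y x)) + nm (Z n (Y x) - Y (Y x))"
        using norm_triangle[of "Z n (Z n x - Y x)" "Z n (Y x) - Y (Y x)"] x Z_in Y_in
        by (simp only: diff_in)
      also have "\<dots> \<le> r * nm (Z n x - Y x) + nm (Z n (Y x) - Y (Y x))"
        using x Z_in Y_in by (intro add_right_mono Z_bound) auto
      finally show "norm (nm (Z n (Z n x) - Y (Y x)))
          \<le> r * nm (Z n x - Y x) + nm (Z n (Y x) - Y (Y x))"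
        using x Z_in Y_in by simp
    next
      show "(\<lambda>n. r * nm (Z n x - Y x) + nm (Z n (Y x) - Y (Y x))) \<longlonglongrightarrow> 0"
        using tendsto_add[OF tendsto_mult_left[OF lim[OF x], of r] lim[OF Y_in[OF x]]] by simp
    qed
    then have "(\<lambda>n. nm ((R x + Z n (Z n x)) - (R x + Y (Y x)))) \<longlonglongrightarrow> 0"
      by simp
    then have "(\<lambda>n. nm (Z (Suc n) x - sc (1/2) (R x + Y (Y x)))) \<longlonglongrightarrow> 0"
      unfolding Z_Suc using x Z_in Y_in R_in by (intro conv_scale) auto
    then have "Y x = sc (1/2) (R x + Y (Y x))"
      using x Z_in Y_in R_in LIMSEQ_Suc[OF lim[OF x]]
      by (intro limit_unique[of "\<lambda>n. Z (Suc n) x"]) auto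
    then have "Y x + Y x = sc (1/2 + 1/2) (R x + Y (Y x))"
      by (simp only: V.scale_left_distrib)
    then show ?thesis by simp
  qed
  ultimately show ?thesis using that Y_bound by blast
qed

text \<open>
  For \<open>b\<close> a bound of the norm of \<open>S\<close>, the operator \<open>R = 1 - S / b\<close> is a strict contraction, since
  \<open>S\<close> is bounded below. With \<open>Y\<close> obtained from \<open>R\<close> by the iteration above, \<open>\<surd>b (1 - Y)\<close> is a
  square root \<open>T\<close> of \<open>S\<close>. The inverse of \<open>T\<close> is \<open>T\<close> composed with the inverse of \<open>S\<close>, which commutes with \<open>T\<close>.
\<close>

lemma positive_invertible_sqrt:
  assumes S: "bounded_op X X S" and pos: "positive_op X S" and inv: "invertible_op X S"
  obtains T g where "bounded_op X X T" "positive_op X T" "bounded_op X X g"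
    and "\<And>x y. x \<in> C \<Longrightarrow> y \<in> C \<Longrightarrow> ip (T x) y = ip x (T y)"
    and "\<And>x. x \<in> C \<Longrightarrow> T (T x) = S x"
    and "\<And>x. x \<in> C \<Longrightarrow> g (T x) = x" "\<And>x. x \<in> C \<Longrightarrow> T (g x) = x"
proof -
  note S_in = bounded_opD(1)[OF S] and S_sym = positive_op_symmetric[OF S pos]
  obtain h where h: "bounded_op X X h" and hS: "\<And>x. x \<in> C \<Longrightarrow> h (S x) = x"
    and Sh: "\<And>x. x \<in> C \<Longrightarrow> S (h x) = x"
    using inv by (auto simp: invertible_op_def)
  note h_in = bounded_opD(1)[OF h]
  obtain b where b: "b \<ge> 1" "\<And>x. x \<in> C \<Longrightarrow> nm (S x) \<le> b * nm x"
    using bounded_op_bound[OF S hilbert_space_axioms] by blast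
  obtain d where d: "d \<ge> 1" "\<And>x. x \<in> C \<Longrightarrow> nm (h x) \<le> d * nm x"
    using bounded_op_bound[OF h hilbert_space_axioms] by blast
  define R where "R x = x - sc (of_real (1 / b)) (S x)" for x
  \<comment> \<open>The lower bound \<open>\<parallel>S x\<parallel> \<ge> \<parallel>x\<parallel> / d\<close> will give \<open>\<parallel>R x\<parallel>\<^sup>2 \<le> (1 - 1 / (d b)\<^sup>2) \<parallel>x\<parallel>\<^sup>2\<close>.\<close>
  define r where "r = sqrt (1 - 1 / (d * b)\<^sup>2)"
  have db: "1 \<le> d * b" using b(1) d(1) by (metis mult_mono mult_1 order_trans zero_le_one)
  have r: "0 \<le> r" "r < 1" and r_sq: "r\<^sup>2 = 1 - 1 / (d * b)\<^sup>2"
    using db one_le_power[OF db, of 2] by (auto simp: r_def divide_le_eq_1)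
  have R_in: "R x \<in> C" if "x \<in> C" for x using that S_in by (simp add: R_def)
  have R_bound: "nm (R x) \<le> r * nm x" if x: "x \<in> C" for x
  proof -
    \<comment> \<open>Positivity of \<open>S\<close> at \<open>R x = x - S x / b\<close> gives \<open>\<langle>S x, x\<rangle> \<ge> \<parallel>S x\<parallel>\<^sup>2 / b\<close>.\<close>
    have SS: "Re (ip (S (S x)) (S x)) \<le> b * (nm (S x))\<^sup>2"
    proof -
      have "Re (ip (S (S x)) (S x)) \<le> nm (S (S x)) * nm (S x)"
        using Cauchy_Schwarz[of "S (S x)" "S x"] complex_Re_le_cmod S_in[OF x] S_in order_trans by blast
      also have "\<dots> \<le> b * nm (S x) * nm (S x)"
        using b(2) S_in x by (intro mult_right_mono) auto
      finally show ?thesis by (simp add: power2_eq_square mult.assoc)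
    qed
    have "S (R x) = S x - sc (of_real (1 / b)) (S (S x))"
      unfolding R_def using x S_in bounded_op_diff[OF hilbert_space_axioms S] bounded_opD(3)[OF S]
      by simp
    then have "ip (S (R x)) (R x) = ip (S x - sc (of_real (1 / b)) (S (S x))) (x - sc (of_real (1 / b)) (S x))"
      by (simp only: R_def)
    also have "\<dots> = ip (S x) x - of_real (1 / b) * ip (S x) (S x)
        - of_real (1 / b) * ip (S (S x)) x + of_real (1 / b) * (of_real (1 / b) * ip (S (S x)) (S x))"
      using x S_in by (simp add: inner_simps algebra_simps)
    also have "ip (S (S x)) x = ip (S x) (S x)" using S_sym S_in x by simp
    finally have "Re (ip (S (R x)) (R x)) = Re (ip (S x) x) - (1 / b) * (nm (S x))\<^sup>2
        - (1 / b) * (nm (S x))\<^sup>2 + (1 / b) * ((1 / b) * Re (ip (S (S x)) (S x)))"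
      using x S_in by (simp only: inner_self Re_complex_of_real minus_complex.simps plus_complex.simps
          flip: of_real_mult) (simp add: Re_divide_of_real)
    moreover have "0 \<le> Re (ip (S (R x)) (R x))"
      using pos R_in[OF x] by (auto simp: positive_op_def complex_nonneg_Reals_iff)
    moreover have "(1 / b) * ((1 / b) * Re (ip (S (S x)) (S x))) \<le> (1 / b) * ((1 / b) * (b * (nm (S x))\<^sup>2))"
      using SS b(1) by (intro mult_left_mono) auto
    ultimately have Sx: "(nm (S x))\<^sup>2 / b \<le> Re (ip (S x) x)"
      using b(1) by simp
    have "nm x \<le> d * nm (S x)" using d(2)[of "S x"] hS S_in x by simp
    then have "(nm x)\<^sup>2 \<le> (d * nm (S x))\<^sup>2" using x by (intro power_mono) auto
    then have low: "(nm x)\<^sup>2 / (d * b)\<^sup>2 \<le> (nm (S x))\<^sup>2 / b\<^sup>2"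
      using d(1) b(1) by (simp add: power_mult_distrib divide_simps mult_ac)
    have "(nm (R x))\<^sup>2 = (nm x)\<^sup>2 - 2 * (Re (ip (S x) x) / b) + (nm (S x))\<^sup>2 / b\<^sup>2"
      using x S_in b(1) S_sym[OF x x]
      by (simp add: R_def norm_diff_sq norm_scale inner_scale_right power_divide
          norm_divide Re_divide_of_real)
    also have "\<dots> \<le> (nm x)\<^sup>2 - (nm (S x))\<^sup>2 / b\<^sup>2"
      using divide_right_mono[OF Sx, of b] b(1) by (simp add: power2_eq_square)
    also have "\<dots> \<le> (nm x)\<^sup>2 - (nm x)\<^sup>2 / (d * b)\<^sup>2" using low by simp
    also have "\<dots> = (r * nm x)\<^sup>2" by (simp add: power_mult_distrib r_sq algebra_simps)
    finally show ?thesis by (rule power2_le_imp_le) (use x r in simp)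
  qed
  have "bounded_op X X R"
    by (rule bounded_opI[OF R_in _ _ R_bound])
      (auto simp: R_def bounded_opD[OF S] V.scale_right_distrib V.scale_right_diff_distrib
        V.scale_left_commute)
  moreover have "ip (R x) y = ip x (R y)" if "x \<in> C" "y \<in> C" for x y
    using that S_in S_sym by (simp add: R_def inner_simps)
  ultimately obtain Y where Y: "bounded_op X X Y"
    and Y_sym: "\<And>x y. x \<in> C \<Longrightarrow> y \<in> C \<Longrightarrow> ip (Y x) y = ip x (Y y)"
    and Y_bound: "\<And>x. x \<in> C \<Longrightarrow> nm (Y x) \<le> r * nm x"
    and Y_fix: "\<And>x. x \<in> C \<Longrightarrow> Y x + Y x = R x + Y (Y x)"
    using sqrt_iteration[OF _ _ R_bound r] by blast
  note Y_in = bounded_opD(1)[OF Y]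
  define T where "T x = sc (of_real (sqrt b)) (x - Y x)" for x
  have T_in: "T x \<in> C" if "x \<in> C" for x using that Y_in by (simp add: T_def)
  have T_bound: "nm (T x) \<le> 2 * sqrt b * nm x" if x: "x \<in> C" for x
  proof -
    have "nm (x - Y x) \<le> nm x + nm (Y x)"
      using norm_triangle_diff[of x 0 "Y x"] norm_minus_commute[of 0 "Y x"] Y_in x by simp
    also have "nm (Y x) \<le> 1 * nm x"
      using Y_bound[OF x] r x by (meson mult_right_mono norm_nonneg less_imp_le order_trans)
    finally have "nm (x - Y x) \<le> 2 * nm x" by simp
    then have "sqrt b * nm (x - Y x) \<le> sqrt b * (2 * nm x)"
      using b(1) by (intro mult_left_mono) auto
    then show ?thesis using x Y_in b(1) by (simp add: T_def norm_scale)
  qed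
  have T: "bounded_op X X T"
    by (rule bounded_opI[OF T_in _ _ T_bound])
      (auto simp: T_def bounded_opD[OF Y] V.scale_right_distrib V.scale_right_diff_distrib
        mult.commute)
  have T_sym: "ip (T x) y = ip x (T y)" if "x \<in> C" "y \<in> C" for x y
    using that Y_in Y_sym by (simp add: T_def inner_simps)
  have T_sq: "T (T x) = S x" if x: "x \<in> C" for x
  proof -
    let ?s = "of_real (sqrt b) :: complex"
    have "T (T x) = sc ?s (T (x - Y x))"
      unfolding T_def[of x] using x Y_in by (intro bounded_opD(3)[OF T]) auto
    also have "T (x - Y x) = sc ?s ((x - Y x) - (Y x - Y (Y x)))"
      using bounded_op_diff[OF hilbert_space_axioms Y x Y_in[OF x]] by (simp add: T_def)
    also have "(x - Y x) - (Y x - Y (Y x)) = x - R x"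
      using Y_fix[OF x] by (simp add: algebra_simps)
    also have "sc ?s (sc ?s (x - R x)) = sc (of_real b) (x - R x)"
      using b(1) by (simp flip: of_real_mult)
    also have "\<dots> = S x" using b(1) by (simp add: R_def)
    finally show ?thesis .
  qed
  have "positive_op X T"
    unfolding positive_op_def
  proof
    fix x assume x: "x \<in> C"
    have "Im (ip (T x) x) = 0"
      using T_sym[OF x x] inner_commute[of x "T x"] T_in x by (simp add: complex_eq_iff)
    moreover have "Re (ip (Y x) x) \<le> (nm x)\<^sup>2"
    proof -
      have "Re (ip (Y x) x) \<le> nm (Y x) * nm x"
        using Cauchy_Schwarz[of "Y x" x] complex_Re_le_cmod Y_in x order_trans by blast
      also have "\<dots> \<le> 1 * nm x * nm x"
        using Y_bound[OF x] r x
        by (intro mult_right_mono) (meson mult_right_mono norm_nonneg less_imp_le order_trans, simp)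
      finally show ?thesis by (simp add: power2_eq_square)
    qed
    then have "0 \<le> Re (ip (T x) x)"
      using x Y_in b(1) by (simp add: T_def inner_simps norm_sq)
    ultimately show "ip (T x) x \<in> \<real>\<^sub>\<ge>\<^sub>0" by (simp add: complex_nonneg_Reals_iff)
  qed
  \<comment> \<open>\<open>T\<close> commutes with \<open>S = T\<^sup>2\<close>, hence with the inverse of \<open>S\<close>.\<close>
  moreover have "T (h x) = h (T x)" if x: "x \<in> C" for x
  proof -
    have "h (T x) = h (T (S (h x)))" using Sh x by simp
    also have "T (S (h x)) = S (T (h x))" using T_sq T_in h_in x by metis
    finally show ?thesis using hS T_in h_in x by simp
  qed
  then have "T (h (T x)) = x" "T (T (h x)) = x" if "x \<in> C" for x
    using that T_in h_in hS Sh T_sq by auto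
  ultimately show ?thesis
    using that[of T "T \<circ> h"] T T_sym T_sq
      bounded_op_comp[OF hilbert_space_axioms hilbert_space_axioms h T]
    by simp
qed

end

section \<open>Hilbert sums of copies of a Hilbert space\<close>

text \<open>
  The Hilbert sum of copies of \<open>Y\<close> indexed by \<open>J\<close>. Families indexed by \<open>J\<close> are represented as
  functions vanishing outside \<open>J\<close>.
\<close>

definition ell2 :: "'j set \<Rightarrow> ('o::ab_group_add, 'm) hspace_scheme \<Rightarrow> ('j \<Rightarrow> 'o) hspace" where
  "ell2 J Y =
     \<lparr>hcarrier = {f. (\<forall>j. f j \<in> hcarrier Y) \<and> (\<forall>j. j \<notin> J \<longrightarrow> f j = 0) \<and>
        (\<lambda>j. (hnorm Y (f j))\<^sup>2) summable_on J},
      hscale = (\<lambda>c f j. hscale Y c (f j)),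
      hinner = (\<lambda>f g. \<Sum>\<^sub>\<infinity>j\<in>J. hinner Y (f j) (g j))\<rparr>"

text \<open>The family with the entry \<open>x\<close> at \<open>j\<close> and zero elsewhere.\<close>

definition single :: "'j \<Rightarrow> 'o::zero \<Rightarrow> 'j \<Rightarrow> 'o" where
  "single j x = (\<lambda>i. if i = j then x else 0)"

lemma single_apply: "single j x i = (if i = j then x else 0)"
  by (simp add: single_def)

context hilbert_space
begin

lemma ell2_iff:
  "f \<in> hcarrier (ell2 J X) \<longleftrightarrow>
    (\<forall>j. f j \<in> C) \<and> (\<forall>j. j \<notin> J \<longrightarrow> f j = 0) \<and> (\<lambda>j. (nm (f j))\<^sup>2) summable_on J"
  by (simp add: ell2_def)

lemma ell2_scale: "hscale (ell2 J X) c f = (\<lambda>j. sc c (f j))"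
  by (simp add: ell2_def)

lemma ell2_inner_summable:
  assumes f: "f \<in> hcarrier (ell2 J X)" and g: "g \<in> hcarrier (ell2 J X)"
  shows "(\<lambda>j. ip (f j) (g j)) summable_on J"
proof (rule abs_summable_summable, rule summable_on_comparison_test)
  show "(\<lambda>j. (nm (f j))\<^sup>2 + (nm (g j))\<^sup>2) summable_on J"
    using f g by (intro summable_on_add) (auto simp: ell2_iff)
  fix j
  have fg: "f j \<in> C" "g j \<in> C" using f g by (auto simp: ell2_iff)
  have "2 * (nm (f j) * nm (g j)) \<le> (nm (f j))\<^sup>2 + (nm (g j))\<^sup>2"
    using sum_squares_bound[of "nm (f j)" "nm (g j)"] by (simp add: mult.assoc)
  moreover have "0 \<le> nm (f j) * nm (g j)" using fg by simp
  ultimately show "norm (ip (f j) (g j)) \<le> (nm (f j))\<^sup>2 + (nm (g j))\<^sup>2"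
    using Cauchy_Schwarz[OF fg] by linarith
qed simp

lemma ell2_inner_has_sum:
  assumes "f \<in> hcarrier (ell2 J X)" "g \<in> hcarrier (ell2 J X)"
  shows "((\<lambda>j. ip (f j) (g j)) has_sum hinner (ell2 J X) f g) J"
  using has_sum_infsum[OF ell2_inner_summable[OF assms]] by (simp add: ell2_def)

lemma ell2_inner_eqI:
  assumes "((\<lambda>j. ip (f j) (g j)) has_sum a) J"
  shows "hinner (ell2 J X) f g = a"
  using infsumI[OF assms] by (simp add: ell2_def)

lemma ell2_norm_sq_has_sum:
  assumes f: "f \<in> hcarrier (ell2 J X)"
  shows "((\<lambda>j. (nm (f j))\<^sup>2) has_sum (hnorm (ell2 J X) f)\<^sup>2) J"
proof -
  have "((\<lambda>j. (nm (f j))\<^sup>2) has_sum Re (hinner (ell2 J X) f f)) J"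
    using has_sum_Re[OF ell2_inner_has_sum[OF f f]] f by (simp add: ell2_iff norm_sq)
  moreover from this have "0 \<le> Re (hinner (ell2 J X) f f)"
    by (rule has_sum_nonneg) simp
  ultimately show ?thesis by (simp add: hnorm_def[of "ell2 J X"])
qed

lemma ell2_norm_nonneg:
  assumes f: "f \<in> hcarrier (ell2 J X)"
  shows "0 \<le> hnorm (ell2 J X) f"
  using has_sum_nonneg[OF has_sum_Re[OF ell2_inner_has_sum[OF f f]]] f
  by (simp add: hnorm_def[of "ell2 J X"] ell2_iff inner_self_nonneg)

lemma ell2_norm_coord:
  assumes f: "f \<in> hcarrier (ell2 J X)"
  shows "nm (f j) \<le> hnorm (ell2 J X) f"
proof (cases "j \<in> J")
  case True
  then have "(nm (f j))\<^sup>2 \<le> (hnorm (ell2 J X) f)\<^sup>2"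
    using finite_sum_le_has_sum[OF ell2_norm_sq_has_sum[OF f], of "{j}"] by simp
  then show ?thesis using ell2_norm_nonneg[OF f] by (rule power2_le_imp_le)
next
  case False
  then show ?thesis using f ell2_norm_nonneg[OF f] by (simp add: ell2_iff)
qed

lemma ell2_bounded_sums:
  assumes "\<And>j. f j \<in> C" "\<And>j. j \<notin> J \<Longrightarrow> f j = 0"
    and bound: "\<And>I. finite I \<Longrightarrow> I \<subseteq> J \<Longrightarrow> (\<Sum>j\<in>I. (nm (f j))\<^sup>2) \<le> B\<^sup>2" and B: "0 \<le> B"
  shows "f \<in> hcarrier (ell2 J X)" "hnorm (ell2 J X) f \<le> B"
proof -
  have "(\<lambda>j. (nm (f j))\<^sup>2) summable_on J"
    by (rule nonneg_bdd_above_summable_on) (auto intro!: bdd_aboveI2[of _ _ "B\<^sup>2"] bound)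
  then show f: "f \<in> hcarrier (ell2 J X)" using assms by (simp add: ell2_iff)
  have "(hnorm (ell2 J X) f)\<^sup>2 \<le> B\<^sup>2"
    using ell2_norm_sq_has_sum[OF f] bound by (rule has_sum_le_finite_sums)
  then show "hnorm (ell2 J X) f \<le> B" using B by (rule power2_le_imp_le)
qed

lemma ell2_add:
  assumes f: "f \<in> hcarrier (ell2 J X)" and g: "g \<in> hcarrier (ell2 J X)"
  shows "f + g \<in> hcarrier (ell2 J X)"
proof -
  have "(\<lambda>j. (nm (f j + g j))\<^sup>2) summable_on J"
  proof (rule summable_on_comparison_test)
    show "(\<lambda>j. 2 * (nm (f j))\<^sup>2 + 2 * (nm (g j))\<^sup>2) summable_on J"
      using f g by (intro summable_on_add summable_on_cmult_right) (auto simp: ell2_iff)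
    fix j
    have "f j \<in> C" "g j \<in> C" using f g by (auto simp: ell2_iff)
    then show "(nm (f j + g j))\<^sup>2 \<le> 2 * (nm (f j))\<^sup>2 + 2 * (nm (g j))\<^sup>2"
      using norm_parallelogram[of "f j" "g j"] zero_le_power2[of "nm (f j - g j)"] by linarith
  qed simp
  then show ?thesis using f g by (simp add: ell2_iff)
qed

lemma ell2_scale_in:
  assumes f: "f \<in> hcarrier (ell2 J X)"
  shows "hscale (ell2 J X) c f \<in> hcarrier (ell2 J X)"
proof -
  have "(\<lambda>j. (cmod c)\<^sup>2 * (nm (f j))\<^sup>2) summable_on J"
    using f by (intro summable_on_cmult_right) (simp add: ell2_iff)
  then show ?thesis using f
    by (simp add: ell2_iff ell2_scale norm_scale power_mult_distrib)
qed

text \<open>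
  A Cauchy sequence converges in each coordinate. The finite partial sums of the squared distances
  pass to the coordinatewise limit, which therefore differs from a member of the sequence by an
  element of small norm.
\<close>

lemma ell2_complete:
  assumes s: "\<And>n. s n \<in> hcarrier (ell2 J X)"
    and diff: "\<And>m n. s m - s n \<in> hcarrier (ell2 J X)"
    and Cauchy: "\<And>e. 0 < e \<Longrightarrow> \<exists>N. \<forall>m\<ge>N. \<forall>n\<ge>N. hnorm (ell2 J X) (s m - s n) < e"
  shows "\<exists>l\<in>hcarrier (ell2 J X). (\<lambda>n. hnorm (ell2 J X) (s n - l)) \<longlonglongrightarrow> 0"
proof -
  have s_in: "s n j \<in> C" and s_0: "j \<notin> J \<Longrightarrow> s n j = 0" for n j
    using s[of n] by (auto simp: ell2_iff)
  have "\<exists>l\<in>C. (\<lambda>n. nm (s n j - l)) \<longlonglongrightarrow> 0" for j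
  proof (rule complete[OF s_in])
    fix e :: real assume "0 < e"
    then show "\<exists>N. \<forall>m\<ge>N. \<forall>n\<ge>N. nm (s m j - s n j) < e"
      using Cauchy[of e] ell2_norm_coord[OF diff, of _ _ j] by (metis minus_apply order.strict_trans1)
  qed
  then obtain l where l: "\<And>j. l j \<in> C" and lim: "\<And>j. (\<lambda>n. nm (s n j - l j)) \<longlonglongrightarrow> 0"
    by metis
  have l_0: "l j = 0" if "j \<notin> J" for j
    by (rule limit_unique[OF s_in l zero_in lim]) (simp add: s_0[OF that])
  have tail: "s n - l \<in> hcarrier (ell2 J X) \<and> hnorm (ell2 J X) (s n - l) \<le> e"
    if e: "0 < e" and N: "\<And>m k. N \<le> m \<Longrightarrow> N \<le> k \<Longrightarrow> hnorm (ell2 J X) (s m - s k) < e"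
      and n: "N \<le> n" for e N n
  proof -
    have sum: "(\<Sum>j\<in>I. (nm ((s n - l) j))\<^sup>2) \<le> e\<^sup>2" if I: "finite I" "I \<subseteq> J" for I
    proof (rule LIMSEQ_le_const2)
      have "(\<lambda>m. nm (s n j - s m j)) \<longlonglongrightarrow> nm (s n j - l j)" for j
      proof (rule tendsto_norm)
        show "(\<lambda>m. nm (s n j - s m j - (s n j - l j))) \<longlonglongrightarrow> 0"
          using lim[of j] norm_minus_commute[OF s_in l] by simp
      qed (use s_in l in auto)
      then show "(\<lambda>m. \<Sum>j\<in>I. (nm (s n j - s m j))\<^sup>2) \<longlonglongrightarrow> (\<Sum>j\<in>I. (nm ((s n - l) j))\<^sup>2)"
        by (auto intro!: tendsto_sum tendsto_power)
      have "(\<Sum>j\<in>I. (nm (s n j - s m j))\<^sup>2) \<le> e\<^sup>2" if "N \<le> m" for m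
      proof -
        have "(\<Sum>j\<in>I. (nm ((s n - s m) j))\<^sup>2) \<le> (hnorm (ell2 J X) (s n - s m))\<^sup>2"
          by (rule finite_sum_le_has_sum[OF ell2_norm_sq_has_sum[OF diff] I]) simp
        also have "\<dots> \<le> e\<^sup>2"
          using N[OF n that] ell2_norm_nonneg[OF diff] by (intro power_mono) auto
        finally show ?thesis by simp
      qed
      then show "\<exists>N. \<forall>m\<ge>N. (\<Sum>j\<in>I. (nm (s n j - s m j))\<^sup>2) \<le> e\<^sup>2" by blast
    qed
    show ?thesis
      using ell2_bounded_sums[of "s n - l" J e] sum e s_in l s_0 l_0 by simp
  qed
  obtain N where "\<And>m k. N \<le> m \<Longrightarrow> N \<le> k \<Longrightarrow> hnorm (ell2 J X) (s m - s k) < 1"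
    using Cauchy[of 1] by auto
  then have "s N - l \<in> hcarrier (ell2 J X)" using tail[of 1 N N] by simp
  then have "s N + hscale (ell2 J X) (- 1) (s N - l) \<in> hcarrier (ell2 J X)"
    by (intro ell2_add s ell2_scale_in)
  moreover have "s N + hscale (ell2 J X) (- 1) (s N - l) = l"
    by (simp add: ell2_scale fun_eq_iff)
  ultimately have "l \<in> hcarrier (ell2 J X)" by simp
  moreover have "(\<lambda>n. hnorm (ell2 J X) (s n - l)) \<longlonglongrightarrow> 0"
  proof (rule LIMSEQ_I)
    fix e :: real assume e: "0 < e"
    then obtain N where N: "\<And>m k. N \<le> m \<Longrightarrow> N \<le> k \<Longrightarrow> hnorm (ell2 J X) (s m - s k) < e / 2"
      using Cauchy[of "e / 2"] by auto
    have "norm (hnorm (ell2 J X) (s n - l) - 0) < e" if "N \<le> n" for n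
    proof -
      have "s n - l \<in> hcarrier (ell2 J X)" and "hnorm (ell2 J X) (s n - l) \<le> e / 2"
        using tail[of "e / 2" N n] N e that by auto
      moreover have "0 \<le> hnorm (ell2 J X) (s n - l)"
        by (rule ell2_norm_nonneg[OF calculation(1)])
      ultimately show ?thesis using e by simp
    qed
    then show "\<exists>N. \<forall>n\<ge>N. norm (hnorm (ell2 J X) (s n - l) - 0) < e" by blast
  qed
  ultimately show ?thesis by blast
qed

lemma hilbert_space_ell2: "hilbert_space (ell2 (J :: 'b set) X)"
proof -
  let ?K = "ell2 J X"
  have vs: "vector_space (hscale ?K)"
    by unfold_locales
      (simp_all add: ell2_scale fun_eq_iff V.scale_right_distrib V.scale_left_distrib)
  interpret W: vector_space "hscale ?K" by (rule vs)
  have sub: "W.subspace (hcarrier ?K)"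
    by (rule W.subspaceI) (simp add: ell2_iff, simp_all add: ell2_add ell2_scale_in)
  show ?thesis
  proof (rule hilbert_space.intro)
    show "vector_space (hscale ?K)" "W.subspace (hcarrier ?K)" by (fact vs, fact sub)
  next
    fix f g h assume fgh: "f \<in> hcarrier ?K" "g \<in> hcarrier ?K" "h \<in> hcarrier ?K"
    show "hinner ?K (f + g) h = hinner ?K f h + hinner ?K g h"
      using has_sum_add[OF ell2_inner_has_sum[OF fgh(1,3)] ell2_inner_has_sum[OF fgh(2,3)]] fgh
      by (intro ell2_inner_eqI) (simp add: ell2_iff inner_add)
  next
    fix f g c assume fg: "f \<in> hcarrier ?K" "g \<in> hcarrier ?K"
    show "hinner ?K (hscale ?K c f) g = c * hinner ?K f g"
      using has_sum_cmult_right[OF ell2_inner_has_sum[OF fg], of c] fg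
      by (intro ell2_inner_eqI) (simp add: ell2_scale ell2_iff inner_scale)
  next
    fix f g assume fg: "f \<in> hcarrier ?K" "g \<in> hcarrier ?K"
    have "cnj (ip (g j) (f j)) = ip (f j) (g j)" for j
      using fg by (intro inner_commute[symmetric]) (auto simp: ell2_iff)
    then have "((\<lambda>j. ip (f j) (g j)) has_sum cnj (hinner ?K g f)) J"
      using has_sum_cnj_iff[THEN iffD2, OF ell2_inner_has_sum[OF fg(2,1)]] by simp
    then show "hinner ?K f g = cnj (hinner ?K g f)" by (rule ell2_inner_eqI)
  next
    fix f assume f: "f \<in> hcarrier ?K" "f \<noteq> 0"
    then obtain j where "f j \<noteq> 0" by (auto simp: fun_eq_iff)
    moreover have "f j \<in> C" using f by (simp add: ell2_iff)
    ultimately have "0 < nm (f j)"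
      by (simp add: order.strict_iff_order norm_eq_0_iff eq_commute[of 0])
    also have "\<dots> \<le> hnorm ?K f" using f by (intro ell2_norm_coord)
    finally show "0 < Re (hinner ?K f f)" by (simp add: hnorm_def[of ?K])
  next
    fix s :: "nat \<Rightarrow> 'b \<Rightarrow> 'a" assume s: "\<And>n. s n \<in> hcarrier ?K"
      and Cauchy: "\<And>e. 0 < e \<Longrightarrow> \<exists>N. \<forall>m\<ge>N. \<forall>n\<ge>N. hnorm ?K (s m - s n) < e"
    show "\<exists>l\<in>hcarrier ?K. (\<lambda>n. hnorm ?K (s n - l)) \<longlonglongrightarrow> 0"
      by (rule ell2_complete[OF s W.subspace_diff[OF sub s s] Cauchy])
  qed
qed

lemma single_inner_has_sum:
  assumes "j \<in> J" "x \<in> C" "\<And>i. f i \<in> C"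
  shows "((\<lambda>i. ip (single j x i) (f i)) has_sum ip x (f j)) J"
  by (rule has_sum_finite_neutralI[of "{j}"]) (use assms in \<open>auto simp: single_apply\<close>)

lemma single_in:
  assumes "j \<in> J" "x \<in> C"
  shows "single j x \<in> hcarrier (ell2 J X)"
proof -
  have "((\<lambda>i. (nm (single j x i))\<^sup>2) has_sum (nm x)\<^sup>2) J"
    by (rule has_sum_finite_neutralI[of "{j}"]) (use assms in \<open>auto simp: single_apply\<close>)
  then show ?thesis
    using assms by (auto simp: ell2_iff single_apply intro: has_sum_imp_summable)
qed

lemma inner_single:
  assumes "j \<in> J" "x \<in> C" "f \<in> hcarrier (ell2 J X)"
  shows "hinner (ell2 J X) (single j x) f = ip x (f j)"
  by (intro ell2_inner_eqI single_inner_has_sum) (use assms in \<open>auto simp: ell2_iff\<close>)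

lemma norm_single:
  assumes "j \<in> J" "x \<in> C"
  shows "hnorm (ell2 J X) (single j x) = nm x"
  using inner_single[OF assms single_in[OF assms]] by (simp add: hnorm_def single_apply)

lemma closed_span_singles:
  "closed_span (ell2 J X) (\<Union>j\<in>J. single j ` C) = hcarrier (ell2 J X)"
proof
  let ?K = "ell2 J X" and ?S = "\<Union>j\<in>J. single j ` C"
  interpret K: hilbert_space ?K by (rule hilbert_space_ell2)
  show "hcarrier ?K \<subseteq> closed_span ?K ?S"
    unfolding closed_span_def
  proof (intro subsetI CollectI conjI allI impI)
    fix f and e :: real assume f: "f \<in> hcarrier ?K" and e: "0 < e"
    have f_in: "f j \<in> C" for j using f by (simp add: ell2_iff)
    have "(sum (\<lambda>j. (nm (f j))\<^sup>2) \<longlongrightarrow> (hnorm ?K f)\<^sup>2) (finite_subsets_at_top J)"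
      using ell2_norm_sq_has_sum[OF f] by (simp add: has_sum_def)
    then have "\<forall>\<^sub>F I in finite_subsets_at_top J. (hnorm ?K f)\<^sup>2 - e\<^sup>2 < (\<Sum>j\<in>I. (nm (f j))\<^sup>2)"
      using e by (intro order_tendstoD(1)) auto
    then obtain I where I: "finite I" "I \<subseteq> J" and le: "(hnorm ?K f)\<^sup>2 - e\<^sup>2 < (\<Sum>j\<in>I. (nm (f j))\<^sup>2)"
      by (auto simp: eventually_finite_subsets_at_top)
    define y where "y = (\<Sum>j\<in>I. single j (f j))"
    have single_span: "single j (f j) \<in> K.V.span ?S" if "j \<in> I" for j
      using that I f_in by (intro K.V.span_base) auto
    then have y: "y \<in> K.V.span ?S"
      unfolding y_def by (rule K.V.span_sum)
    have y_in: "y \<in> hcarrier ?K"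
      unfolding y_def using I f_in by (intro K.sum_in single_in) auto
    \<comment> \<open>Both \<open>\<parallel>y\<parallel>\<^sup>2\<close> and \<open>\<langle>y, f\<rangle>\<close> equal the partial sum over \<open>I\<close>, so \<open>\<parallel>f - y\<parallel>\<^sup>2\<close> is the tail.\<close>
    have y_apply: "y i = (if i \<in> I then f i else 0)" for i
    proof -
      have "y i = (\<Sum>j\<in>I. single j (f j) i)"
        unfolding y_def by (induction I rule: infinite_finite_induct) auto
      also have "\<dots> = (if i \<in> I then f i else 0)"
        using I by (simp add: single_apply)
      finally show ?thesis .
    qed
    have inner_y: "hinner ?K y g = (\<Sum>j\<in>I. ip (f j) (g j))" if "g \<in> hcarrier ?K" for g
      unfolding y_def using that I f_in
      by (subst K.inner_sum_left) (auto simp: single_in inner_single intro!: sum.cong)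
    have "hinner ?K y y = (\<Sum>j\<in>I. ip (f j) (f j))"
      unfolding inner_y[OF y_in] by (intro sum.cong) (auto simp: y_apply)
    moreover have "hinner ?K y f = (\<Sum>j\<in>I. ip (f j) (f j))" by (rule inner_y[OF f])
    moreover have "Re (hinner ?K f y) = Re (hinner ?K y f)"
      using K.inner_commute[OF f y_in] by simp
    ultimately have "(hnorm ?K (f - y))\<^sup>2 = (hnorm ?K f)\<^sup>2 - (\<Sum>j\<in>I. (nm (f j))\<^sup>2)"
      using f y_in f_in by (simp add: K.norm_diff_sq K.norm_sq[of y] norm_sq)
    then have "(hnorm ?K (f - y))\<^sup>2 < e\<^sup>2" using le by linarith
    then have "hnorm ?K (f - y) < e" using e by (simp add: power2_less_imp_less)
    then show "\<exists>y\<in>K.V.span ?S. hnorm ?K (f - y) < e" using y by blast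
  qed
qed (auto simp: closed_span_def)

end

section \<open>Dilation of operator-valued frames\<close>

text \<open>
  Strong convergence of \<open>\<Sum>j\<in>J. (A j)\<^sup>* (A j)\<close> to \<open>S\<close> yields \<open>\<Sum>j\<in>J. \<parallel>A j x\<parallel>\<^sup>2 = \<langle>S x, x\<rangle>\<close>.
\<close>

lemma sot_has_sum_norms:
  assumes H: "hilbert_space H" and Ho: "hilbert_space Ho"
    and A: "\<And>j. j \<in> J \<Longrightarrow> bounded_op H Ho (A j)"
    and sot: "sot_has_sum H (\<lambda>j. adj H Ho (A j) \<circ> A j) J S"
    and x: "x \<in> hcarrier H" and Sx: "S x \<in> hcarrier H"
  shows "((\<lambda>j. (hnorm Ho (A j x))\<^sup>2) has_sum Re (hinner H (S x) x)) J"
proof -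
  interpret H: hilbert_space H by (rule H)
  interpret Ho: hilbert_space Ho by (rule Ho)
  define u where "u j = (adj H Ho (A j) \<circ> A j) x" for j
  have u_in: "u j \<in> hcarrier H" and u_inner: "Re (hinner H (u j) x) = (hnorm Ho (A j x))\<^sup>2"
    if j: "j \<in> J" for j
  proof -
    have Ax: "A j x \<in> hcarrier Ho" by (rule bounded_opD(1)[OF A[OF j] x])
    show u: "u j \<in> hcarrier H" using adj_in[OF H Ho A[OF j] Ax] by (simp add: u_def)
    have "hinner H x (u j) = hinner Ho (A j x) (A j x)"
      using adj_inner[OF H Ho A[OF j] Ax x] by (simp add: u_def)
    then show "Re (hinner H (u j) x) = (hnorm Ho (A j x))\<^sup>2"
      using H.inner_commute[OF u x] Ax by (simp add: Ho.norm_sq)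
  qed
  \<comment> \<open>Partial sums over \<open>I \<inter> J\<close> lie in \<open>H\<close> for every \<open>I\<close>, and not only eventually.\<close>
  have ev: "\<forall>\<^sub>F I in finite_subsets_at_top J. I \<inter> J = I"
    by (rule eventually_finite_subsets_at_top_weakI) auto
  have "((\<lambda>I. hnorm H ((\<Sum>j\<in>I. u j) - S x)) \<longlongrightarrow> 0) (finite_subsets_at_top J)"
    using sot x by (simp add: sot_has_sum_def u_def)
  then have "((\<lambda>I. hnorm H ((\<Sum>j\<in>I \<inter> J. u j) - S x)) \<longlongrightarrow> 0) (finite_subsets_at_top J)"
    by (rule Lim_transform_eventually) (use ev in \<open>auto elim!: eventually_mono\<close>)
  then have "((\<lambda>I. hinner H (\<Sum>j\<in>I \<inter> J. u j) x) \<longlongrightarrow> hinner H (S x) x) (finite_subsets_at_top J)"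
    using u_in by (intro H.tendsto_inner_left Sx x H.sum_in) auto
  then have "((\<lambda>I. Re (hinner H (\<Sum>j\<in>I \<inter> J. u j) x)) \<longlongrightarrow> Re (hinner H (S x) x))
      (finite_subsets_at_top J)"
    by (rule tendsto_Re)
  moreover have "Re (hinner H (\<Sum>j\<in>I \<inter> J. u j) x) = (\<Sum>j\<in>I \<inter> J. (hnorm Ho (A j x))\<^sup>2)" for I
    using u_in x u_inner by (subst H.inner_sum_left) auto
  ultimately have "((\<lambda>I. \<Sum>j\<in>I \<inter> J. (hnorm Ho (A j x))\<^sup>2) \<longlongrightarrow> Re (hinner H (S x) x))
      (finite_subsets_at_top J)"
    by simp
  then have "((\<lambda>I. \<Sum>j\<in>I. (hnorm Ho (A j x))\<^sup>2) \<longlongrightarrow> Re (hinner H (S x) x))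
      (finite_subsets_at_top J)"
    by (rule Lim_transform_eventually) (use ev in \<open>auto elim!: eventually_mono\<close>)
  then show ?thesis by (simp add: has_sum_def)
qed

text \<open>
  The dilation of a Parseval family \<open>B\<close>: \<open>\<iota>\<close> is the analysis operator \<open>h \<mapsto> (B j h)\<^sub>j\<close>,
  \<open>\<kappa>\<close> is the inclusion of a fixed summand, and \<open>V j\<close> shifts this summand to the \<open>j\<close>-th one.
\<close>

lemma parseval_dilation:
  fixes H :: "('h::ab_group_add, 'm) hspace_scheme"
    and Ho :: "('o::ab_group_add, 'n) hspace_scheme"
    and J :: "'j set"
  assumes H: "hilbert_space H" and Ho: "hilbert_space Ho" and J: "J \<noteq> {}"
    and B: "\<And>j. j \<in> J \<Longrightarrow> bounded_op H Ho (B j)"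
    and norm_B: "\<And>h. h \<in> hcarrier H \<Longrightarrow>
      ((\<lambda>j. (hnorm Ho (B j h))\<^sup>2) has_sum (hnorm H h)\<^sup>2) J"
  shows "\<exists>(K :: ('j \<Rightarrow> 'o) hspace) \<iota> \<kappa> V.
    dilation_system H Ho J K \<iota> \<kappa> V \<and>
    (\<forall>j\<in>J. \<forall>h\<in>hcarrier H. \<kappa> (B j h) = adj K K (V j) (\<iota> h))"
proof -
  interpret H: hilbert_space H by (rule H)
  interpret Ho: hilbert_space Ho by (rule Ho)
  define K where "K = ell2 J Ho"
  have hilbert_K: "hilbert_space K" unfolding K_def by (rule Ho.hilbert_space_ell2)
  interpret K: hilbert_space K by (rule hilbert_K)
  note scale_K = Ho.ell2_scale[of J, folded K_def]
  note norm_coord = Ho.ell2_norm_coord[of _ J, folded K_def]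
  have K_in: "f j \<in> hcarrier Ho" if "f \<in> hcarrier K" for f j
    using that by (auto simp: K_def Ho.ell2_iff)
  note single_in = Ho.single_in[of _ J, folded K_def]
    and norm_single = Ho.norm_single[of _ J, folded K_def]
    and inner_single = Ho.inner_single[of _ J, folded K_def]
  have inner_single_right: "hinner K f (single j x) = hinner Ho (f j) x"
    if "j \<in> J" "x \<in> hcarrier Ho" "f \<in> hcarrier K" for f j x
    using that inner_single[OF that] K.inner_commute[OF that(3) single_in] Ho.inner_commute[of "f j" x] K_in
    by simp
  obtain j0 where j0: "j0 \<in> J" using J by blast
  define \<iota> where "\<iota> h = (\<lambda>j. if j \<in> J then B j h else 0)" for h
  define \<kappa> :: "'o \<Rightarrow> 'j \<Rightarrow> 'o" where "\<kappa> = single j0"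
  define V :: "'j \<Rightarrow> ('j \<Rightarrow> 'o) \<Rightarrow> 'j \<Rightarrow> 'o" where "V j f = single j (f j0)" for j f
  have single_add: "single j (x + y) = single j x + single j y" for j and x y :: 'o
    by (auto simp: single_apply fun_eq_iff)
  have single_scale: "single j (hscale Ho c x) = hscale K c (single j x)" for j c x
    by (auto simp: scale_K single_apply fun_eq_iff)

  have \<iota>_in: "\<iota> h \<in> hcarrier K" and \<iota>_norm: "hnorm K (\<iota> h) = hnorm H h" if h: "h \<in> hcarrier H" for h
  proof -
    have sum: "((\<lambda>j. (hnorm Ho (\<iota> h j))\<^sup>2) has_sum (hnorm H h)\<^sup>2) J"
      using norm_B[OF h] by (simp add: \<iota>_def cong: has_sum_cong)
    then show i: "\<iota> h \<in> hcarrier K"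
      using bounded_opD(1)[OF B h]
      by (auto simp: K_def Ho.ell2_iff \<iota>_def intro: has_sum_imp_summable)
    have "(hnorm K (\<iota> h))\<^sup>2 = (hnorm H h)\<^sup>2"
      using has_sum_unique[OF Ho.ell2_norm_sq_has_sum[OF i[unfolded K_def]] sum] by (simp add: K_def)
    then show "hnorm K (\<iota> h) = hnorm H h"
      using K.norm_nonneg[OF i] H.norm_nonneg[OF h] by (rule power2_eq_imp_eq)
  qed
  have "bounded_op H K \<iota>"
    unfolding bounded_op_def
  proof (intro conjI ballI allI exI[of _ 1])
    show "\<iota> (x + y) = \<iota> x + \<iota> y" if "x \<in> hcarrier H" "y \<in> hcarrier H" for x y
      using that bounded_opD(2)[OF B] by (auto simp: \<iota>_def fun_eq_iff)
    show "\<iota> (hscale H c x) = hscale K c (\<iota> x)" if "x \<in> hcarrier H" for c x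
      using that bounded_opD(3)[OF B] by (auto simp: \<iota>_def fun_eq_iff scale_K)
  qed (auto simp: \<iota>_in \<iota>_norm)
  then have iso_\<iota>: "linear_isometry H K \<iota>" by (simp add: linear_isometry_def \<iota>_norm)
  have iso_\<kappa>: "linear_isometry Ho K \<kappa>"
    unfolding linear_isometry_def bounded_op_def \<kappa>_def
    using j0 by (auto simp: single_in norm_single single_add single_scale intro!: exI[of _ 1])
  have V: "bounded_op K K (V j)" if j: "j \<in> J" for j
    unfolding bounded_op_def
  proof (intro conjI ballI allI exI[of _ 1])
    show "hnorm K (V j f) \<le> 1 * hnorm K f" if "f \<in> hcarrier K" for f
      using j that norm_coord[OF that] K_in[OF that] by (simp add: V_def norm_single)
  qed (use j in \<open>auto simp: V_def single_in K_in single_add scale_K single_scale\<close>)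
  have init: "initial_space K (V j) = \<kappa> ` hcarrier Ho" if j: "j \<in> J" for j
  proof
    show "\<kappa> ` hcarrier Ho \<subseteq> initial_space K (V j)"
    proof
      fix f assume "f \<in> \<kappa> ` hcarrier Ho"
      then obtain x where x: "x \<in> hcarrier Ho" and f: "f = single j0 x" by (auto simp: \<kappa>_def)
      have "hinner K f g = 0" if "g \<in> hcarrier K" "V j g = 0" for g
      proof -
        have "g j0 = V j g j" by (simp add: V_def single_apply)
        then have "g j0 = 0" using that by simp
        then show ?thesis using inner_single[OF j0 x that(1)] x f by simp
      qed
      then show "f \<in> initial_space K (V j)"
        using single_in[OF j0 x] by (simp add: initial_space_def f)
    qed
    show "initial_space K (V j) \<subseteq> \<kappa> ` hcarrier Ho"
    proof
      fix f assume f: "f \<in> initial_space K (V j)"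
      then have f_in: "f \<in> hcarrier K" by (simp add: initial_space_def)
      \<comment> \<open>The part of \<open>f\<close> off \<open>j0\<close> is in the kernel of \<open>V j\<close> and orthogonal to both \<open>f\<close> and
        the part of \<open>f\<close> at \<open>j0\<close>.\<close>
      define g where "g = f - single j0 (f j0)"
      have g_in: "g \<in> hcarrier K"
        unfolding g_def by (intro K.diff_in f_in single_in j0 K_in[OF f_in])
      have g0: "g j0 = 0" by (simp add: g_def single_apply)
      then have "V j g = 0" by (auto simp: V_def single_apply fun_eq_iff)
      then have "hinner K f g = 0" using f g_in by (simp add: initial_space_def)
      moreover have "hinner K (single j0 (f j0)) g = 0"
        using inner_single[OF j0 K_in[OF f_in] g_in] g0 K_in[OF f_in] by simp
      moreover have "hinner K g g = hinner K f g - hinner K (single j0 (f j0)) g"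
        using K.inner_diff_left[OF f_in single_in[OF j0 K_in[OF f_in, of j0]] g_in]
        unfolding g_def[symmetric] .
      ultimately have "hinner K g g = 0" by simp
      then have "g = 0" using K.norm_eq_0_iff[OF g_in] by (simp add: hnorm_def)
      then have "f = \<kappa> (f j0)" by (simp add: g_def \<kappa>_def)
      then show "f \<in> \<kappa> ` hcarrier Ho" using K_in[OF f_in] by blast
    qed
  qed
  have V_\<kappa>: "V j (\<kappa> x) = single j x" for j x
    by (simp add: V_def \<kappa>_def single_apply)
  have part: "partial_isometry K (V j)" if j: "j \<in> J" for j
    unfolding partial_isometry_def init[OF j]
    using V[OF j] j j0 by (auto simp: V_\<kappa> norm_single) (simp add: \<kappa>_def norm_single)
  have range_V: "V j ` hcarrier K = single j ` hcarrier Ho" if "j \<in> J" for j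
  proof
    show "V j ` hcarrier K \<subseteq> single j ` hcarrier Ho" using K_in by (auto simp: V_def)
    have "single j x = V j (\<kappa> x) \<and> \<kappa> x \<in> hcarrier K" if "x \<in> hcarrier Ho" for x
      using that j0 V_\<kappa> by (simp add: \<kappa>_def single_in)
    then show "single j ` hcarrier Ho \<subseteq> V j ` hcarrier K" by blast
  qed
  have "closed_span K (\<Union>j\<in>J. V j ` hcarrier K) = hcarrier K"
    using Ho.closed_span_singles[of J] range_V by (simp flip: K_def)
  moreover have "hinner K (V i f) (V j g) = 0"
    if "i \<in> J" "j \<in> J" "i \<noteq> j" "f \<in> hcarrier K" "g \<in> hcarrier K" for i j f g
    using that K_in inner_single[of i "f j0" "V j g"] bounded_opD(1)[OF V]
    by (simp add: V_def single_apply)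
  ultimately have "dilation_system H Ho J K \<iota> \<kappa> V"
    unfolding dilation_system_def using hilbert_K iso_\<iota> iso_\<kappa> part init by blast
  moreover have "\<kappa> (B j h) = adj K K (V j) (\<iota> h)" if j: "j \<in> J" and h: "h \<in> hcarrier H" for j h
  proof (rule sym, rule adj_eqI[OF hilbert_K])
    have Bh: "B j h \<in> hcarrier Ho" by (rule bounded_opD(1)[OF B[OF j] h])
    then show "\<kappa> (B j h) \<in> hcarrier K" using j0 by (simp add: \<kappa>_def single_in)
    fix f assume f: "f \<in> hcarrier K"
    have "hinner K (V j f) (\<iota> h) = hinner Ho (f j0) (B j h)"
      using inner_single[OF j K_in[OF f] \<iota>_in[OF h]] j by (simp add: V_def \<iota>_def)
    also have "\<dots> = hinner K f (\<kappa> (B j h))"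
      using inner_single_right[OF j0 Bh f] by (simp add: \<kappa>_def)
    finally show "hinner K (V j f) (\<iota> h) = hinner K f (\<kappa> (B j h))" .
  qed
  ultimately show ?thesis by blast
qed

theorem proposition2p4:
  fixes H :: "'h::ab_group_add hspace"
    and Ho :: "'o::ab_group_add hspace"
    and J :: "'j set"
    and A :: "'j \<Rightarrow> 'h \<Rightarrow> 'o"
  assumes "hilbert_space H" and "hilbert_space Ho" and "J \<noteq> {}"
    and "operator_valued_frame H Ho J A"
  shows "(\<exists>(K :: ('j \<Rightarrow> 'o) hspace) \<iota> \<kappa> V T.
            dilation_system H Ho J K \<iota> \<kappa> V \<and>
            bounded_op H H T \<and> positive_op H T \<and> invertible_op H T \<and>
            (\<forall>j\<in>J. \<forall>h\<in>hcarrier H. \<kappa> (A j h) = adj K K (V j) (\<iota> (T h))))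
       \<and> (parseval_frame H Ho J A \<longrightarrow>
          (\<exists>(K :: ('j \<Rightarrow> 'o) hspace) \<iota> \<kappa> V.
            dilation_system H Ho J K \<iota> \<kappa> V \<and>
            (\<forall>j\<in>J. \<forall>h\<in>hcarrier H. \<kappa> (A j h) = adj K K (V j) (\<iota> h))))"
proof (intro conjI impI)
  interpret H: hilbert_space H by (rule assms(1))
  have A: "\<And>j. j \<in> J \<Longrightarrow> bounded_op H Ho (A j)"
    using assms(4) by (simp add: operator_valued_frame_def)
  obtain S where S: "bounded_op H H S" "positive_op H S" "invertible_op H S"
    and sot: "sot_has_sum H (\<lambda>j. adj H Ho (A j) \<circ> A j) J S"
    using assms(4) unfolding operator_valued_frame_def by blast
  obtain T g where T: "bounded_op H H T" "positive_op H T" and g: "bounded_op H H g"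
    and T_sym: "\<And>x y. x \<in> hcarrier H \<Longrightarrow> y \<in> hcarrier H \<Longrightarrow> hinner H (T x) y = hinner H x (T y)"
    and T_sq: "\<And>x. x \<in> hcarrier H \<Longrightarrow> T (T x) = S x"
    and gT: "\<And>x. x \<in> hcarrier H \<Longrightarrow> g (T x) = x" and Tg: "\<And>x. x \<in> hcarrier H \<Longrightarrow> T (g x) = x"
    by (rule H.positive_invertible_sqrt[OF S]) blast
  have inv: "invertible_op H T" using g gT Tg by (auto simp: invertible_op_def)
  \<comment> \<open>The family \<open>A j \<circ> g\<close>, where \<open>g\<close> is the inverse of \<open>T\<close>, is Parseval: \<open>\<langle>S (g h), g h\<rangle> = \<parallel>h\<parallel>\<^sup>2\<close>.\<close>
  have norms: "((\<lambda>j. (hnorm Ho ((A j \<circ> g) h))\<^sup>2) has_sum (hnorm H h)\<^sup>2) J"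
    if h: "h \<in> hcarrier H" for h
  proof -
    have gh: "g h \<in> hcarrier H" by (rule bounded_opD(1)[OF g h])
    have "hinner H (S (g h)) (g h) = hinner H (T h) (g h)"
      using T_sq[OF gh] Tg[OF h] by simp
    also have "\<dots> = hinner H h h" using T_sym[OF h gh] Tg[OF h] by simp
    finally have "Re (hinner H (S (g h)) (g h)) = (hnorm H h)\<^sup>2" by (simp add: H.norm_sq[OF h])
    then show ?thesis
      using sot_has_sum_norms[OF assms(1,2) A sot gh bounded_opD(1)[OF S(1) gh]] by simp
  qed
  obtain K :: "('j \<Rightarrow> 'o) hspace" and \<iota> \<kappa> V where D: "dilation_system H Ho J K \<iota> \<kappa> V"
    and adj: "\<forall>j\<in>J. \<forall>h\<in>hcarrier H. \<kappa> ((A j \<circ> g) h) = adj K K (V j) (\<iota> h)"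
    using parseval_dilation[OF assms(1-3) bounded_op_comp[OF assms(1,1) g A] norms] by fast
  have "\<kappa> (A j h) = adj K K (V j) (\<iota> (T h))" if "j \<in> J" "h \<in> hcarrier H" for j h
    using adj[rule_format, OF that(1) bounded_opD(1)[OF T(1) that(2)]] gT[OF that(2)] by simp
  with D T inv show "\<exists>(K :: ('j \<Rightarrow> 'o) hspace) \<iota> \<kappa> V T.
      dilation_system H Ho J K \<iota> \<kappa> V \<and>
      bounded_op H H T \<and> positive_op H T \<and> invertible_op H T \<and>
      (\<forall>j\<in>J. \<forall>h\<in>hcarrier H. \<kappa> (A j h) = adj K K (V j) (\<iota> (T h)))"
    by blast

  assume "parseval_frame H Ho J A"
  then have sot_id: "sot_has_sum H (\<lambda>j. adj H Ho (A j) \<circ> A j) J id"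
    by (simp add: parseval_frame_def)
  have norm_A: "((\<lambda>j. (hnorm Ho (A j h))\<^sup>2) has_sum (hnorm H h)\<^sup>2) J" if h: "h \<in> hcarrier H" for h
    using sot_has_sum_norms[OF assms(1,2) A sot_id h] h by (simp add: H.norm_sq)
  show "\<exists>(K :: ('j \<Rightarrow> 'o) hspace) \<iota> \<kappa> V.
      dilation_system H Ho J K \<iota> \<kappa> V \<and>
      (\<forall>j\<in>J. \<forall>h\<in>hcarrier H. \<kappa> (A j h) = adj K K (V j) (\<iota> h))"
    using parseval_dilation[OF assms(1-3) A norm_A] .
qed

end
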